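(* If $M$ is a closed SYS manifold, then $M\times\mathbb R$ is an open SYS manifold.
   Context: All homology and cohomology groups have integer coefficients. A closed orientable manifold $M^n$ is SYS if there are $\beta_1,\dots,\beta_{n-2}\in H^1(M)$ such that $[M]\frown(\beta_1\smile\cdots\smile\beta_{n-2})\in H_2(M)$ does not lie in the image of the Hurewicz map $\pi_2(M)\to H_2(M)$. In the following definitions $M$ denotes an arbitrary $n$-manifold without boundary (possibly non-compact) with an exhaustion $K_1\subseteq K_2\subseteq\cdots$ by compact sets (with $K_i\subset \mathrm{Int}\,K_{i+1}$). An end of $M$ is a decreasing sequence $U_1\supseteq U_2\supseteq\cdots$ where $U_i$ is a connected component of $M\setminus K_i$. Let $\mathcal B(M)$ be the collection of subsets $V\subset M$ with compact boundary. For $V\in\mathcal B(M)$, $\partial_\infty V$ denotes the collection of ends $\{U_i\}$ with $U_i\subset V$ for all sufficiently large $i$. Put $C_*(M,\partial_\infty V):=\varprojlim_i C_*(M,V\setminus K_i)$ (singular chains), with homology $H_*(M,\partial_\infty V)$, and $H^*(M,\partial_\infty V):=\varinjlim_i H^*(M,V\setminus K_i)$. With $V^c=M\setminus V$, write $\partial_sM:=\partial_\infty V$ and $\partial_bM:=\partial_\infty V^c$; then $\partial_\infty M=\partial_sM\sqcup\partial_bM$ is called the ends-decomposition induced by $V$. The cap product with the fundamental class $[M]\in H_n(M,\partial_\infty M)$ maps $H^k(M,\partial_bM)$ to $H_{n-k}(M,\partial_sM)$. If $\Omega\subset M$ is closed and $\overline{\Omega\,\Delta\, V^c}$ is compact,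 then $V\setminus K_i\subset M\setminus\Omega$ for large $i$, and for $\tau\in H_2(M,\partial_sM)$ the restricted class $\tau|_\Omega\in H_2(M,M\setminus\Omega)$ is the image of $\tau$ under $H_2(M,\partial_sM)\to H_2(M,V\setminus K_i)\to H_2(M,M\setminus\Omega)$. A class $\tau\in H_2(M,\partial_sM)$ is spherical if for every closed $\Omega\subset M$ with $\overline{\Omega\,\Delta\,V^c}$ compact, $\tau|_\Omega$ is in the image of the Hurewicz map $\pi_2(M,M\setminus\Omega)\to H_2(M,M\setminus\Omega)$; otherwise $\tau$ is aspherical. Here the image of the Hurewicz map is understood as the subgroup generated by the classes of all maps $(D^2,\partial D^2)\to(M,M\setminus\Omega)$ and $S^2\to M$ (all basepoints allowed). An open SYS manifold is an orientable manifold $M^n$ (possibly non-compact) for which there are $V\in\mathcal B(M)$, with induced ends-decomposition $\partial_\infty M=\partial_sM\sqcup\partial_bM$, a class $\beta_1\in H^1(M,\partial_bM)$ and classes $\beta_2,\dots,\beta_{n-2}\in H^1(M)$ such that $[M]\frown(\beta_1\smile\cdots\smile\beta_{n-2})\in H_2(M,\partial_sM)$ is aspherical. *)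

theory Defs
  imports "HOL-Analysis.Analysis" "HOL-Homology.Homology"
begin

section \<open>Singular cohomology with integer coefficients\<close>

text \<open>
  A \<open>p\<close>-cochain is an integer-valued function on singular \<open>p\<close>-simplices; it is normalised to be
  \<open>0\<close> outside the singular \<open>p\<close>-simplices of \<open>X\<close>, so that cochains of \<open>(X, A)\<close> correspond
  bijectively to homomorphisms \<open>C\<^sub>p(X) / C\<^sub>p(A) \<rightarrow> \<int>\<close>.
\<close>

type_synonym 'a cochain = "((nat \<Rightarrow> real) \<Rightarrow> 'a) \<Rightarrow> int"

definition singular_cochain :: "nat \<Rightarrow> 'a topology \<Rightarrow> 'a set \<Rightarrow> 'a cochain \<Rightarrow> bool" where
  "singular_cochain p X A \<phi> \<longleftrightarrow>
     (\<forall>\<sigma>. \<not> singular_simplex p X \<sigma> \<longrightarrow> \<phi> \<sigma> = 0) \<and>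
     (\<forall>\<sigma>. singular_simplex p (subtopology X A) \<sigma> \<longrightarrow> \<phi> \<sigma> = 0)"

definition cochain_eval :: "'a cochain \<Rightarrow> 'a chain \<Rightarrow> int" where
  "cochain_eval \<phi> c = (\<Sum>\<sigma>\<in>Poly_Mapping.keys c. Poly_Mapping.lookup c \<sigma> * \<phi> \<sigma>)"

definition cochain_coboundary :: "nat \<Rightarrow> 'a topology \<Rightarrow> 'a cochain \<Rightarrow> 'a cochain" where
  "cochain_coboundary p X \<phi> = (\<lambda>\<sigma>.
     if singular_simplex (Suc p) X \<sigma>
     then cochain_eval \<phi> (chain_boundary (Suc p) (frag_of \<sigma>)) else 0)"

definition singular_cocycle :: "nat \<Rightarrow> 'a topology \<Rightarrow> 'a set \<Rightarrow> 'a cochain \<Rightarrow> bool" where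
  "singular_cocycle p X A \<phi> \<longleftrightarrow>
     singular_cochain p X A \<phi> \<and> cochain_coboundary p X \<phi> = (\<lambda>\<sigma>. 0)"

definition singular_coboundary :: "nat \<Rightarrow> 'a topology \<Rightarrow> 'a set \<Rightarrow> 'a cochain \<Rightarrow> bool" where
  "singular_coboundary p X A \<phi> \<longleftrightarrow>
     \<phi> = (\<lambda>\<sigma>. 0) \<or>
     (\<exists>q \<eta>. p = Suc q \<and> singular_cochain q X A \<eta> \<and> \<phi> = cochain_coboundary q X \<eta>)"

definition cohomologous :: "nat \<Rightarrow> 'a topology \<Rightarrow> 'a set \<Rightarrow> ('a cochain \<times> 'a cochain) set" where
  "cohomologous p X A =
     {(\<phi>, \<psi>). singular_cocycle p X A \<phi> \<and> singular_cocycle p X A \<psi> \<and>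
              singular_coboundary p X A (\<lambda>\<sigma>. \<phi> \<sigma> - \<psi> \<sigma>)}"

abbreviation cohomology_class :: "nat \<Rightarrow> 'a topology \<Rightarrow> 'a set \<Rightarrow> 'a cochain \<Rightarrow> 'a cochain set" where
  "cohomology_class p X A \<phi> \<equiv> cohomologous p X A `` {\<phi>}"

definition cohomology :: "nat \<Rightarrow> 'a topology \<Rightarrow> 'a set \<Rightarrow> 'a cochain set set" where
  "cohomology p X A = Collect (singular_cocycle p X A) // cohomologous p X A"


section \<open>Cup and cap products\<close>

text \<open>
  The front \<open>p\<close>-face \<open>\<sigma>|[v\<^sub>0, \<dots>, v\<^sub>p]\<close> and the back \<open>q\<close>-face \<open>\<sigma>|[v\<^sub>k, \<dots>, v\<^bsub>k+q\<^esub>]\<close>. Since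
  points of standard simplices are sequences, the standard \<open>p\<close>-simplex literally is the front face
  of every larger one.
\<close>

definition front_face :: "nat \<Rightarrow> ((nat \<Rightarrow> real) \<Rightarrow> 'a) \<Rightarrow> (nat \<Rightarrow> real) \<Rightarrow> 'a" where
  "front_face p \<sigma> = restrict \<sigma> (standard_simplex p)"

definition back_face :: "nat \<Rightarrow> nat \<Rightarrow> ((nat \<Rightarrow> real) \<Rightarrow> 'a) \<Rightarrow> (nat \<Rightarrow> real) \<Rightarrow> 'a" where
  "back_face k q \<sigma> = (\<lambda>t\<in>standard_simplex q. \<sigma> (\<lambda>i. if i < k then 0 else t (i - k)))"

definition cochain_cup ::
    "nat \<Rightarrow> nat \<Rightarrow> 'a topology \<Rightarrow> 'a cochain \<Rightarrow> 'a cochain \<Rightarrow> 'a cochain" where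
  "cochain_cup p q X \<phi> \<psi> = (\<lambda>\<sigma>.
     if singular_simplex (p + q) X \<sigma> then \<phi> (front_face p \<sigma>) * \<psi> (back_face p q \<sigma>) else 0)"

text \<open>
  The convention is \<open>\<sigma> \<frown> \<phi> = \<phi>(\<sigma>|[v\<^sub>0, \<dots>, v\<^sub>k]) \<cdot> \<sigma>|[v\<^sub>k, \<dots>, v\<^bsub>k+q\<^esub>]\<close> for a \<open>(k+q)\<close>-simplex \<open>\<sigma>\<close>
  and a \<open>k\<close>-cochain \<open>\<phi>\<close>, so \<open>c \<frown> (\<phi> \<smile> \<psi>) = (c \<frown> \<phi>) \<frown> \<psi>\<close>.
\<close>

definition chain_cap :: "nat \<Rightarrow> nat \<Rightarrow> 'a chain \<Rightarrow> 'a cochain \<Rightarrow> 'a chain" where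
  "chain_cap k q c \<phi> =
     frag_extend (\<lambda>\<sigma>. frag_cmul (\<phi> (front_face k \<sigma>)) (frag_of (back_face k q \<sigma>))) c"

text \<open>
  Operations on classes are the unions of the resulting classes over all representatives, which is a
  single class because the operation respects the equivalence relation.
  The cup product is \<open>H\<^sup>p(X, A) \<times> H\<^sup>q(X) \<rightarrow> H\<^bsup>p+q\<^esup>(X, A)\<close>.
\<close>

definition cup ::
    "nat \<Rightarrow> nat \<Rightarrow> 'a topology \<Rightarrow> 'a set \<Rightarrow> 'a cochain set \<Rightarrow> 'a cochain set \<Rightarrow> 'a cochain set" where
  "cup p q X A a b = (\<Union>\<phi>\<in>a. \<Union>\<psi>\<in>b. cohomology_class (p + q) X A (cochain_cup p q X \<phi> \<psi>))"

definition cohomology_unit :: "'a topology \<Rightarrow> 'a cochain set" where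
  "cohomology_unit X =
     cohomology_class 0 X {} (\<lambda>\<sigma>. if singular_simplex 0 X \<sigma> then 1 else 0)"

text \<open>The cup product in \<open>H\<^bsup>m\<^esup>(X)\<close> of a list of \<open>m\<close> classes in \<open>H\<^sup>1(X)\<close>.\<close>

fun cup_list :: "'a topology \<Rightarrow> 'a cochain set list \<Rightarrow> 'a cochain set" where
  "cup_list X [] = cohomology_unit X"
| "cup_list X (b # bs) = cup 1 (length bs) X {} b (cup_list X bs)"

definition cap ::
    "nat \<Rightarrow> nat \<Rightarrow> 'a topology \<Rightarrow> 'a chain set \<Rightarrow> 'a cochain set \<Rightarrow> 'a chain set" where
  "cap k q X \<mu> b = (\<Union>c\<in>\<mu>. \<Union>\<phi>\<in>b. homologous_rel_set q X {} (chain_cap k q c \<phi>))"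


section \<open>The Hurewicz image in degree 2\<close>

definition generates_group :: "('g, 'm) monoid_scheme \<Rightarrow> 'g \<Rightarrow> bool" where
  "generates_group G u \<longleftrightarrow> u \<in> carrier G \<and> carrier (subgroup_generated G {u}) = carrier G"

definition disc2 :: "(nat \<Rightarrow> real) topology" where
  "disc2 = subtopology (Euclidean_space 2) {x. (\<Sum>i<2. (x i)\<^sup>2) \<le> 1}"

definition circle1 :: "(nat \<Rightarrow> real) set" where
  "circle1 = topspace (nsphere 1)"

text \<open>
  The class of a map is the image of a generator of \<open>H\<^sub>2(D\<^sup>2, S\<^sup>1)\<close>, respectively \<open>H\<^sub>2(S\<^sup>2)\<close>; the choice
  of generator does not affect the subgroup. For \<open>A = {}\<close> there are no maps of discs.
\<close>

definition disc_classes :: "'a topology \<Rightarrow> 'a set \<Rightarrow> 'a chain set set" where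
  "disc_classes X A =
     {hom_induced 2 disc2 circle1 X A f u | f u.
        continuous_map disc2 X f \<and> f ` circle1 \<subseteq> A \<and>
        generates_group (relative_homology_group 2 disc2 circle1) u}"

definition sphere_classes :: "'a topology \<Rightarrow> 'a set \<Rightarrow> 'a chain set set" where
  "sphere_classes X A =
     {hom_induced 2 (nsphere 2) {} X A f u | f u.
        continuous_map (nsphere 2) X f \<and> generates_group (homology_group 2 (nsphere 2)) u}"

definition hurewicz_image :: "'a topology \<Rightarrow> 'a set \<Rightarrow> 'a chain set set" where
  "hurewicz_image X A =
     carrier (subgroup_generated (relative_homology_group 2 X A)
                (disc_classes X A \<union> sphere_classes X A))"


section \<open>Manifolds and orientations\<close>

definition manifold :: "nat \<Rightarrow> 'a topology \<Rightarrow> bool" where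
  "manifold n X \<longleftrightarrow>
     Hausdorff_space X \<and> second_countable X \<and>
     (\<forall>x\<in>topspace X. \<exists>U W. openin X U \<and> x \<in> U \<and> openin (Euclidean_space n) W \<and>
        subtopology X U homeomorphic_space subtopology (Euclidean_space n) W)"

definition closed_manifold :: "nat \<Rightarrow> 'a topology \<Rightarrow> bool" where
  "closed_manifold n X \<longleftrightarrow> manifold n X \<and> compact_space X"

text \<open>A locally consistent choice of generators of \<open>H\<^sub>n(X, X - {x})\<close>.\<close>

definition orientation :: "nat \<Rightarrow> 'a topology \<Rightarrow> ('a \<Rightarrow> 'a chain set) \<Rightarrow> bool" where
  "orientation n X \<omega> \<longleftrightarrow>
     (\<forall>x\<in>topspace X.
        generates_group (relative_homology_group (int n) X (topspace X - {x})) (\<omega> x)) \<and>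
     (\<forall>x\<in>topspace X. \<exists>U. openin X U \<and> x \<in> U \<and>
        (\<exists>a \<in> carrier (relative_homology_group (int n) X (topspace X - U)).
           \<forall>y\<in>U. hom_induced (int n) X (topspace X - U) X (topspace X - {y}) id a = \<omega> y))"

definition closed_fundamental_class ::
    "nat \<Rightarrow> 'a topology \<Rightarrow> ('a \<Rightarrow> 'a chain set) \<Rightarrow> 'a chain set \<Rightarrow> bool" where
  "closed_fundamental_class n X \<omega> \<mu> \<longleftrightarrow>
     \<mu> \<in> carrier (homology_group (int n) X) \<and>
     (\<forall>x\<in>topspace X. hom_induced (int n) X {} X (topspace X - {x}) id \<mu> = \<omega> x)"

definition closed_SYS :: "nat \<Rightarrow> 'a topology \<Rightarrow> bool" where
  "closed_SYS n X \<longleftrightarrow>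
     2 \<le> n \<and> closed_manifold n X \<and>
     (\<exists>\<omega> \<mu> \<beta>s. orientation n X \<omega> \<and> closed_fundamental_class n X \<omega> \<mu> \<and>
        length \<beta>s = n - 2 \<and> set \<beta>s \<subseteq> cohomology 1 X {} \<and>
        cap (n - 2) 2 X \<mu> (cup_list X \<beta>s) \<notin> hurewicz_image X {})"


section \<open>Homology and cohomology relative to ends\<close>

definition exhaustion :: "'a topology \<Rightarrow> (nat \<Rightarrow> 'a set) \<Rightarrow> bool" where
  "exhaustion X K \<longleftrightarrow>
     (\<forall>i. compactin X (K i)) \<and> (\<forall>i. K i \<subseteq> X interior_of K (Suc i)) \<and> (\<Union>i. K i) = topspace X"

definition compact_frontier :: "'a topology \<Rightarrow> 'a set \<Rightarrow> bool" where
  "compact_frontier X V \<longleftrightarrow> V \<subseteq> topspace X \<and> compactin X (X frontier_of V)"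

text \<open>
  For an exhaustion \<open>K\<close>, homology and cohomology relative to the ends \<open>\<partial>\<^sub>\<infinity>V\<close> are defined
  through the decreasing sequence \<open>W i = V - K i\<close>; they depend on \<open>V\<close> only, so the set of
  ends \<open>\<partial>\<^sub>\<infinity>V\<close> itself does not enter.
\<close>

definition end_nbhds :: "(nat \<Rightarrow> 'a set) \<Rightarrow> 'a set \<Rightarrow> nat \<Rightarrow> 'a set" where
  "end_nbhds K V i = V - K i"

text \<open>
  An element of \<open>lim\<^sub>i C\<^sub>p(X) / C\<^sub>p(W i)\<close> is a compatible family of cosets. It is represented by a
  sequence of chains \<open>c i\<close>, one for each coset; two sequences represent the same element iff
  \<open>c i - d i \<in> C\<^sub>p(W i)\<close> for all \<open>i\<close>. Cycles and boundaries below are those of this inverse limit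
  complex, the identification of representatives being subsumed in \<open>lim_homologous\<close>
  (take the bounding sequence to be \<open>0\<close>).
\<close>

definition lim_chain ::
    "nat \<Rightarrow> 'a topology \<Rightarrow> (nat \<Rightarrow> 'a set) \<Rightarrow> (nat \<Rightarrow> 'a chain) \<Rightarrow> bool" where
  "lim_chain p X W c \<longleftrightarrow>
     (\<forall>i. singular_chain p X (c i)) \<and>
     (\<forall>i. singular_chain p (subtopology X (W i)) (c (Suc i) - c i))"

definition lim_cycle ::
    "nat \<Rightarrow> 'a topology \<Rightarrow> (nat \<Rightarrow> 'a set) \<Rightarrow> (nat \<Rightarrow> 'a chain) \<Rightarrow> bool" where
  "lim_cycle p X W c \<longleftrightarrow> lim_chain p X W c \<and> (\<forall>i. singular_relcycle p X (W i) (c i))"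

definition lim_homologous ::
    "nat \<Rightarrow> 'a topology \<Rightarrow> (nat \<Rightarrow> 'a set) \<Rightarrow> ((nat \<Rightarrow> 'a chain) \<times> (nat \<Rightarrow> 'a chain)) set" where
  "lim_homologous p X W =
     {(c, d). lim_cycle p X W c \<and> lim_cycle p X W d \<and>
        (\<exists>e. lim_chain (Suc p) X W e \<and>
           (\<forall>i. singular_chain p (subtopology X (W i))
                  (c i - d i - chain_boundary (Suc p) (e i))))}"

definition lim_homology ::
    "nat \<Rightarrow> 'a topology \<Rightarrow> (nat \<Rightarrow> 'a set) \<Rightarrow> (nat \<Rightarrow> 'a chain) set set" where
  "lim_homology p X W = Collect (lim_cycle p X W) // lim_homologous p X W"

text \<open>The projection \<open>H\<^sub>p(lim\<^sub>i C\<^sub>*(X, W i)) \<rightarrow> H\<^sub>p(X, W i)\<close>.\<close>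

definition lim_proj ::
    "nat \<Rightarrow> 'a topology \<Rightarrow> (nat \<Rightarrow> 'a set) \<Rightarrow> nat \<Rightarrow> (nat \<Rightarrow> 'a chain) set \<Rightarrow> 'a chain set" where
  "lim_proj p X W i \<tau> = (\<Union>c\<in>\<tau>. homologous_rel_set p X (W i) (c i))"

text \<open>
  The direct limit of the groups \<open>H\<^sup>p(X, W i)\<close>: pairs \<open>(i, a)\<close> with \<open>a \<in> H\<^sup>p(X, W i)\<close> are identified
  when they have the same image in some \<open>H\<^sup>p(X, W m)\<close>. Pulling back along \<open>(X, W m) \<subseteq> (X, W i)\<close>
  does not change cochains.
\<close>

definition cohomology_restrict ::
    "nat \<Rightarrow> 'a topology \<Rightarrow> 'a set \<Rightarrow> 'a cochain set \<Rightarrow> 'a cochain set" where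
  "cohomology_restrict p X A a = (\<Union>\<phi>\<in>a. cohomology_class p X A \<phi>)"

definition colim_pairs ::
    "nat \<Rightarrow> 'a topology \<Rightarrow> (nat \<Rightarrow> 'a set) \<Rightarrow> (nat \<times> 'a cochain set) set" where
  "colim_pairs p X W = (SIGMA i:UNIV. cohomology p X (W i))"

definition colim_rel ::
    "nat \<Rightarrow> 'a topology \<Rightarrow> (nat \<Rightarrow> 'a set) \<Rightarrow>
       ((nat \<times> 'a cochain set) \<times> (nat \<times> 'a cochain set)) set" where
  "colim_rel p X W =
     {((i, a), (j, b)). (i, a) \<in> colim_pairs p X W \<and> (j, b) \<in> colim_pairs p X W \<and>
        (\<exists>m. i \<le> m \<and> j \<le> m \<and> cohomology_restrict p X (W m) a = cohomology_restrict p X (W m) b)}"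

definition colim_cohomology ::
    "nat \<Rightarrow> 'a topology \<Rightarrow> (nat \<Rightarrow> 'a set) \<Rightarrow> (nat \<times> 'a cochain set) set set" where
  "colim_cohomology p X W = colim_pairs p X W // colim_rel p X W"

definition colim_cup ::
    "nat \<Rightarrow> nat \<Rightarrow> 'a topology \<Rightarrow> (nat \<Rightarrow> 'a set) \<Rightarrow>
       (nat \<times> 'a cochain set) set \<Rightarrow> 'a cochain set \<Rightarrow> (nat \<times> 'a cochain set) set" where
  "colim_cup p q X W \<xi> b = (\<Union>(i, a)\<in>\<xi>. colim_rel (p + q) X W `` {(i, cup p q X (W i) a b)})"

text \<open>
  The cap product \<open>H\<^bsub>k+q\<^esub>(X, \<partial>\<^sub>\<infinity>X) \<times> H\<^sup>k(X, \<partial>\<^sub>\<infinity>V\<^sup>c) \<rightarrow> H\<^sub>q(X, \<partial>\<^sub>\<infinity>V)\<close>. Let \<open>\<phi>\<close> vanish on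
  \<open>V\<^sup>c - K i\<close> and let \<open>N \<ge> i\<close> be such that \<open>K N\<close> contains the frontier of \<open>V\<close>. For \<open>j \<ge> N\<close> every
  simplex in \<open>X - K j\<close> lies in \<open>V - K j\<close> or in \<open>V\<^sup>c - K j\<close>, so that the component of the result at
  \<open>j\<close> is the class of \<open>c j \<frown> \<phi>\<close>; for \<open>j < N\<close> the component is the image of the one at \<open>N\<close>.
\<close>

definition end_cap ::
    "nat \<Rightarrow> nat \<Rightarrow> 'a topology \<Rightarrow> (nat \<Rightarrow> 'a set) \<Rightarrow> 'a set \<Rightarrow>
       (nat \<Rightarrow> 'a chain) set \<Rightarrow> (nat \<times> 'a cochain set) set \<Rightarrow> (nat \<Rightarrow> 'a chain) set" where
  "end_cap k q X K V \<mu> \<xi> =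
     (\<Union>c\<in>\<mu>. \<Union>(i, a)\<in>\<xi>. \<Union>\<phi>\<in>a. \<Union>N\<in>{N. i \<le> N \<and> X frontier_of V \<subseteq> K N}.
        lim_homologous q X (end_nbhds K V) `` {\<lambda>j. chain_cap k q (c (max j N)) \<phi>})"

text \<open>The fundamental class in \<open>H\<^sub>n(X, \<partial>\<^sub>\<infinity>X)\<close> of an oriented manifold.\<close>

definition fundamental_class ::
    "nat \<Rightarrow> 'a topology \<Rightarrow> (nat \<Rightarrow> 'a set) \<Rightarrow> ('a \<Rightarrow> 'a chain set) \<Rightarrow> (nat \<Rightarrow> 'a chain) set \<Rightarrow> bool" where
  "fundamental_class n X K \<omega> \<mu> \<longleftrightarrow>
     \<mu> \<in> lim_homology n X (end_nbhds K (topspace X)) \<and>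
     (\<forall>i. \<forall>x \<in> K i.
        hom_induced (int n) X (topspace X - K i) X (topspace X - {x}) id
          (lim_proj n X (end_nbhds K (topspace X)) i \<mu>) = \<omega> x)"


section \<open>Spherical classes and open SYS manifolds\<close>

text \<open>\<open>\<Omega>\<close> is closed and the closure of its symmetric difference with \<open>V\<^sup>c\<close> is compact.\<close>

definition admissible_set :: "'a topology \<Rightarrow> 'a set \<Rightarrow> 'a set \<Rightarrow> bool" where
  "admissible_set X V \<Omega> \<longleftrightarrow>
     closedin X \<Omega> \<and>
     compactin X (X closure_of ((\<Omega> - (topspace X - V)) \<union> ((topspace X - V) - \<Omega>)))"

text \<open>
  The restriction \<open>\<tau>|\<Omega>\<close>. Any index \<open>i\<close> with \<open>V - K i \<subseteq> X - \<Omega>\<close> gives the same class; the least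
  one is used.
\<close>

definition restricted_class ::
    "'a topology \<Rightarrow> (nat \<Rightarrow> 'a set) \<Rightarrow> 'a set \<Rightarrow> 'a set \<Rightarrow> (nat \<Rightarrow> 'a chain) set \<Rightarrow> 'a chain set" where
  "restricted_class X K V \<Omega> \<tau> =
     (let i = (LEAST i. V - K i \<subseteq> topspace X - \<Omega>)
      in hom_induced 2 X (V - K i) X (topspace X - \<Omega>) id (lim_proj 2 X (end_nbhds K V) i \<tau>))"

definition spherical ::
    "'a topology \<Rightarrow> (nat \<Rightarrow> 'a set) \<Rightarrow> 'a set \<Rightarrow> (nat \<Rightarrow> 'a chain) set \<Rightarrow> bool" where
  "spherical X K V \<tau> \<longleftrightarrow>
     (\<forall>\<Omega>. admissible_set X V \<Omega> \<longrightarrow>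
        restricted_class X K V \<Omega> \<tau> \<in> hurewicz_image X (topspace X - \<Omega>))"

abbreviation aspherical ::
    "'a topology \<Rightarrow> (nat \<Rightarrow> 'a set) \<Rightarrow> 'a set \<Rightarrow> (nat \<Rightarrow> 'a chain) set \<Rightarrow> bool" where
  "aspherical X K V \<tau> \<equiv> \<not> spherical X K V \<tau>"

text \<open>
  The relative groups do not depend on the exhaustion \<open>K\<close> up to canonical isomorphism.
  Here \<open>\<beta>1 \<in> H\<^sup>1(X, \<partial>\<^sub>bX)\<close> and \<open>\<beta>s\<close> is the list of the remaining \<open>n - 3\<close> classes in \<open>H\<^sup>1(X)\<close>.
\<close>

definition open_SYS :: "nat \<Rightarrow> 'a topology \<Rightarrow> bool" where
  "open_SYS n X \<longleftrightarrow>
     3 \<le> n \<and> manifold n X \<and>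
     (\<exists>K \<omega> \<mu> V \<beta>1 \<beta>s.
        exhaustion X K \<and> orientation n X \<omega> \<and> fundamental_class n X K \<omega> \<mu> \<and>
        compact_frontier X V \<and>
        \<beta>1 \<in> colim_cohomology 1 X (end_nbhds K (topspace X - V)) \<and>
        length \<beta>s = n - 3 \<and> set \<beta>s \<subseteq> cohomology 1 X {} \<and>
        aspherical X K V
          (end_cap (n - 2) 2 X K V \<mu>
             (colim_cup 1 (n - 3) X (end_nbhds K (topspace X - V)) \<beta>1 (cup_list X \<beta>s))))"

end

theory Submission
  imports Defs
begin

text \<open>
  Take \<open>V = {}\<close>, so that \<open>H\<^sub>*(M \<times> \<real>, \<partial>\<^sub>s)\<close> is absolute homology, let the first class \<open>\<theta>\<close> be the
  pullback of the generator of the compactly supported first cohomology of \<open>\<real>\<close>, and pull the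
  other classes back from \<open>M\<close>. If \<open>c\<close> is a fundamental cycle of \<open>M\<close>, the prisms of \<open>c\<close> over the unit intervals
  \<open>[k, k + 1]\<close> add up to a fundamental class of \<open>M \<times> \<real>\<close>. With \<open>\<theta>\<close> represented by the
  coboundary of the step function at height \<open>0\<close>, the cap product with \<open>\<theta>\<close> kills all of these prisms
  except the one over \<open>[-1, 0]\<close>, which becomes \<open>c \<times> {0}\<close>, already on the level of chains.
  The remaining cap product therefore projects to \<open>[M] \<frown> (\<beta>\<^sub>1 \<smile> \<dots> \<smile> \<beta>\<^bsub>n-2\<^esub>)\<close> in \<open>H\<^sub>2(M)\<close>,
  and the projection \<open>M \<times> \<real> \<rightarrow> M\<close> preserves Hurewicz images.
\<close>

subsection \<open>Evaluation of cochains\<close>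

text \<open>With \<open>V = {}\<close> the complement of \<open>V\<close> is the whole space. So the
  first class must have compact support, and \<open>\<Omega>\<close> may be the whole space: its
  complement is empty, and the restricted class is then the absolute class itself. One such
  \<open>\<Omega>\<close> suffices for asphericity. The main obstacle is to show that the stacked
  prisms generate local homology at every point. This is done from their boundary alone, without a
  Kuenneth formula: a chain that bounds the difference of a copy of c above the point and a copy
  below it must be a local generator. The orientation of the product is then read off from these
  chains, so no sign has to be compared with the orientation of M. The cap product is exact because
  the convention evaluates on front faces: in the simplex [v_0, ..., v_i, w_i, ..., w_n] of a prism
  the leading edge is vertical only for i = 0, and what follows that edge is the top copy
  [w_0, ..., w_n]. Height 0 counts as the upper side of the step, which selects the prism ending
  there.\<close>

lemma cochain_eval_superset:
  assumes "finite S" "Poly_Mapping.keys c \<subseteq> S"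
  shows "cochain_eval \<phi> c = (\<Sum>\<sigma>\<in>S. Poly_Mapping.lookup c \<sigma> * \<phi> \<sigma>)"
  unfolding cochain_eval_def using assms
  by (intro sum.mono_neutral_left) (auto simp: in_keys_iff)

lemma cochain_eval_0 [simp]: "cochain_eval \<phi> 0 = 0"
  by (simp add: cochain_eval_def)

lemma cochain_eval_zero [simp]: "cochain_eval (\<lambda>\<sigma>. 0) c = 0"
  by (simp add: cochain_eval_def)

lemma cochain_eval_of [simp]: "cochain_eval \<phi> (frag_of \<sigma>) = \<phi> \<sigma>"
  by (simp add: cochain_eval_def)

lemma cochain_eval_add: "cochain_eval \<phi> (a + b) = cochain_eval \<phi> a + cochain_eval \<phi> b"
proof -
  let ?S = "Poly_Mapping.keys a \<union> Poly_Mapping.keys b"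
  have "Poly_Mapping.keys (a + b) \<subseteq> ?S"
    by (rule keys_add)
  then show ?thesis
    by (simp add: cochain_eval_superset [of ?S] lookup_add distrib_right sum.distrib)
qed

lemma cochain_eval_cmul: "cochain_eval \<phi> (frag_cmul k a) = k * cochain_eval \<phi> a"
proof -
  have "Poly_Mapping.keys (frag_cmul k a) \<subseteq> Poly_Mapping.keys a"
    by (rule keys_cmul)
  then show ?thesis
    by (simp add: cochain_eval_superset [of "Poly_Mapping.keys a"] sum_distrib_left mult.assoc)
qed

lemma cochain_eval_diff: "cochain_eval \<phi> (a - b) = cochain_eval \<phi> a - cochain_eval \<phi> b"
  using cochain_eval_add [of \<phi> "a - b" b] by simp

lemma cochain_eval_sum: "cochain_eval \<phi> (\<Sum>i\<in>I. f i) = (\<Sum>i\<in>I. cochain_eval \<phi> (f i))"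
  by (induction I rule: infinite_finite_induct) (auto simp: cochain_eval_add)

lemma cochain_eval_cochain_diff:
  "cochain_eval (\<lambda>\<sigma>. \<phi> \<sigma> - \<psi> \<sigma>) c = cochain_eval \<phi> c - cochain_eval \<psi> c"
  by (simp add: cochain_eval_def right_diff_distrib sum_subtractf)

lemma cochain_eval_cochain_mult:
  "cochain_eval (\<lambda>\<sigma>. k * \<phi> \<sigma>) c = k * cochain_eval \<phi> c"
  by (simp add: cochain_eval_def sum_distrib_left mult.left_commute)

lemma cochain_eval_vanishes:
  assumes "singular_chain p (subtopology X A) c" "singular_cochain p X A \<phi>"
  shows "cochain_eval \<phi> c = 0"
  using assms unfolding cochain_eval_def singular_chain_def singular_cochain_def
  by (intro sum.neutral) auto

lemma cochain_eval_boundary_of: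
  "cochain_eval \<phi> (chain_boundary (Suc p) (frag_of \<sigma>)) =
     (\<Sum>i\<le>Suc p. (-1) ^ i * \<phi> (singular_face (Suc p) i \<sigma>))"
  by (simp add: chain_boundary_of cochain_eval_sum cochain_eval_cmul del: sum.atMost_Suc)

text \<open>The coboundary is defined simplex by simplex; both sides are additive in the chain, so
  the identity spreads from generators to all chains of \<open>X\<close>.\<close>

lemma cochain_eval_coboundary:
  assumes "singular_chain (Suc p) X c"
  shows "cochain_eval (cochain_coboundary p X \<phi>) c = cochain_eval \<phi> (chain_boundary (Suc p) c)"
  using assms unfolding singular_chain_def
proof (induction c rule: frag_induction)
  case (one \<sigma>)
  then show ?case
    by (simp add: cochain_coboundary_def)
next
  case (diff a b)
  then show ?case
    by (simp add: cochain_eval_diff chain_boundary_diff)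
qed auto

lemma cochain_coboundary_diff:
  "cochain_coboundary p X (\<lambda>\<sigma>. \<phi> \<sigma> - \<psi> \<sigma>) =
     (\<lambda>\<sigma>. cochain_coboundary p X \<phi> \<sigma> - cochain_coboundary p X \<psi> \<sigma>)"
  by (auto simp: cochain_coboundary_def cochain_eval_cochain_diff)

lemma cochain_coboundary_mult:
  "cochain_coboundary p X (\<lambda>\<sigma>. k * \<phi> \<sigma>) = (\<lambda>\<sigma>. k * cochain_coboundary p X \<phi> \<sigma>)"
  by (auto simp: cochain_coboundary_def cochain_eval_cochain_mult)

lemma cochain_coboundary_zero [simp]: "cochain_coboundary p X (\<lambda>\<sigma>. 0) = (\<lambda>\<sigma>. 0)"
  by (auto simp: cochain_coboundary_def)

lemma cochain_coboundary_coboundary: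
  "cochain_coboundary (Suc p) X (cochain_coboundary p X \<phi>) = (\<lambda>\<sigma>. 0)"
proof
  fix \<sigma>
  show "cochain_coboundary (Suc p) X (cochain_coboundary p X \<phi>) \<sigma> = 0"
  proof (cases "singular_simplex (Suc (Suc p)) X \<sigma>")
    case True
    then have "singular_chain (Suc (Suc p)) X (frag_of \<sigma>)"
      by (simp add: singular_chain_of)
    then have "singular_chain (Suc p) X (chain_boundary (Suc (Suc p)) (frag_of \<sigma>))"
      and "chain_boundary (Suc p) (chain_boundary (Suc (Suc p)) (frag_of \<sigma>)) = 0"
      by (auto intro: singular_chain_boundary_alt chain_boundary_boundary_alt)
    then show ?thesis
      using True by (simp add: cochain_coboundary_def [of "Suc p"] cochain_eval_coboundary)
  qed (simp add: cochain_coboundary_def)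
qed

lemma singular_cochain_0 [simp]: "singular_cochain p X A (\<lambda>\<sigma>. 0)"
  by (simp add: singular_cochain_def)

lemma singular_cochain_diff:
  "\<lbrakk>singular_cochain p X A \<phi>; singular_cochain p X A \<psi>\<rbrakk>
    \<Longrightarrow> singular_cochain p X A (\<lambda>\<sigma>. \<phi> \<sigma> - \<psi> \<sigma>)"
  by (simp add: singular_cochain_def)

lemma singular_cochain_mult:
  "singular_cochain p X A \<phi> \<Longrightarrow> singular_cochain p X A (\<lambda>\<sigma>. k * \<phi> \<sigma>)"
  by (simp add: singular_cochain_def)

lemma singular_cochain_mono:
  "\<lbrakk>singular_cochain p X A \<phi>; B \<subseteq> A\<rbrakk> \<Longrightarrow> singular_cochain p X B \<phi>"
  by (auto simp: singular_cochain_def dest: singular_simplex_mono)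

lemma singular_cochain_coboundary:
  assumes "singular_cochain p X A \<phi>"
  shows "singular_cochain (Suc p) X A (cochain_coboundary p X \<phi>)"
  unfolding singular_cochain_def
proof (intro conjI allI impI)
  fix \<sigma> assume "singular_simplex (Suc p) (subtopology X A) \<sigma>"
  then have "singular_chain p (subtopology X A) (chain_boundary (Suc p) (frag_of \<sigma>))"
    by (intro singular_chain_boundary_alt) (simp add: singular_chain_of)
  then show "cochain_coboundary p X \<phi> \<sigma> = 0"
    using assms by (simp add: cochain_coboundary_def cochain_eval_vanishes)
qed (simp add: cochain_coboundary_def)

lemma singular_cocycle_mono:
  "\<lbrakk>singular_cocycle p X A \<phi>; B \<subseteq> A\<rbrakk> \<Longrightarrow> singular_cocycle p X B \<phi>"
  by (auto simp: singular_cocycle_def intro: singular_cochain_mono)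

lemma singular_cocycle_coboundary:
  "singular_cochain p X A \<phi> \<Longrightarrow> singular_cocycle (Suc p) X A (cochain_coboundary p X \<phi>)"
  by (simp add: singular_cocycle_def singular_cochain_coboundary cochain_coboundary_coboundary)

lemma singular_coboundary_0 [simp]: "singular_coboundary p X A (\<lambda>\<sigma>. 0)"
  by (simp add: singular_coboundary_def)

text \<open>The zero cochain is the coboundary of zero, so in positive degree the two disjuncts of
  the definition merge.\<close>

lemma singular_coboundary_Suc:
  "singular_coboundary (Suc p) X A \<phi> \<longleftrightarrow>
     (\<exists>\<eta>. singular_cochain p X A \<eta> \<and> \<phi> = cochain_coboundary p X \<eta>)"
proof -
  have "(\<lambda>\<sigma>. 0) = cochain_coboundary p X (\<lambda>\<sigma>. 0)"
    by simp
  then show ?thesis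
    unfolding singular_coboundary_def using singular_cochain_0 by blast
qed

lemma singular_coboundary_0_iff: "singular_coboundary 0 X A \<phi> \<longleftrightarrow> \<phi> = (\<lambda>\<sigma>. 0)"
  by (simp add: singular_coboundary_def)

lemma singular_coboundary_diff:
  assumes "singular_coboundary p X A \<phi>" "singular_coboundary p X A \<psi>"
  shows "singular_coboundary p X A (\<lambda>\<sigma>. \<phi> \<sigma> - \<psi> \<sigma>)"
proof (cases p)
  case 0
  then show ?thesis
    using assms by (simp add: singular_coboundary_0_iff)
next
  case (Suc q)
  then obtain \<eta> \<zeta> where "singular_cochain q X A \<eta>" "\<phi> = cochain_coboundary q X \<eta>"
      "singular_cochain q X A \<zeta>" "\<psi> = cochain_coboundary q X \<zeta>"
    using assms singular_coboundary_Suc by blast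
  then show ?thesis
    unfolding Suc singular_coboundary_Suc
    by (intro exI [of _ "\<lambda>\<sigma>. \<eta> \<sigma> - \<zeta> \<sigma>"])
       (simp add: singular_cochain_diff cochain_coboundary_diff)
qed

lemma singular_coboundary_mult:
  assumes "singular_coboundary p X A \<phi>"
  shows "singular_coboundary p X A (\<lambda>\<sigma>. k * \<phi> \<sigma>)"
proof (cases p)
  case 0
  then show ?thesis
    using assms by (simp add: singular_coboundary_0_iff)
next
  case (Suc q)
  then obtain \<eta> where "singular_cochain q X A \<eta>" "\<phi> = cochain_coboundary q X \<eta>"
    using assms singular_coboundary_Suc by blast
  then show ?thesis
    unfolding Suc singular_coboundary_Suc
    by (intro exI [of _ "\<lambda>\<sigma>. k * \<eta> \<sigma>"])
       (simp add: singular_cochain_mult cochain_coboundary_mult)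
qed

lemma singular_coboundary_mono:
  "\<lbrakk>singular_coboundary p X A \<phi>; B \<subseteq> A\<rbrakk> \<Longrightarrow> singular_coboundary p X B \<phi>"
  unfolding singular_coboundary_def using singular_cochain_mono by blast

section \<open>Cohomology classes and their representatives\<close>

lemma equiv_cohomologous: "equiv (Collect (singular_cocycle p X A)) (cohomologous p X A)"
proof (rule equivI)
  show "cohomologous p X A \<subseteq> Collect (singular_cocycle p X A) \<times> Collect (singular_cocycle p X A)"
    by (auto simp: cohomologous_def)
  show "refl_on (Collect (singular_cocycle p X A)) (cohomologous p X A)"
    by (auto simp: cohomologous_def refl_on_def)
  show "sym (cohomologous p X A)"
  proof (rule symI)
    fix \<phi> \<psi> assume "(\<phi>, \<psi>) \<in> cohomologous p X A"
    then show "(\<psi>, \<phi>) \<in> cohomologous p X A"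
      using singular_coboundary_mult [of p X A "\<lambda>\<sigma>. \<phi> \<sigma> - \<psi> \<sigma>" "-1"]
      by (auto simp: cohomologous_def)
  qed
  show "trans (cohomologous p X A)"
  proof (rule transI)
    fix \<phi> \<psi> \<xi> assume "(\<phi>, \<psi>) \<in> cohomologous p X A" "(\<psi>, \<xi>) \<in> cohomologous p X A"
    moreover from this have "singular_coboundary p X A (\<lambda>\<sigma>. -1 * (\<psi> \<sigma> - \<xi> \<sigma>))"
      by (intro singular_coboundary_mult) (auto simp: cohomologous_def)
    ultimately show "(\<phi>, \<xi>) \<in> cohomologous p X A"
      using singular_coboundary_diff [of p X A "\<lambda>\<sigma>. \<phi> \<sigma> - \<psi> \<sigma>" "\<lambda>\<sigma>. -1 * (\<psi> \<sigma> - \<xi> \<sigma>)"]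
      by (auto simp: cohomologous_def)
  qed
qed

lemma cohomology_class_eq:
  "(\<phi>, \<psi>) \<in> cohomologous p X A \<Longrightarrow> cohomology_class p X A \<phi> = cohomology_class p X A \<psi>"
  using equiv_class_eq equiv_cohomologous by metis

lemma cohomology_class_self:
  "singular_cocycle p X A \<phi> \<Longrightarrow> \<phi> \<in> cohomology_class p X A \<phi>"
  by (simp add: cohomologous_def)

lemma cohomology_class_in:
  "singular_cocycle p X A \<phi> \<Longrightarrow> cohomology_class p X A \<phi> \<in> cohomology p X A"
  by (simp add: cohomology_def quotientI)

lemma cohomology_class_eqD:
  "\<lbrakk>cohomology_class p X A \<phi> = cohomology_class p X A \<psi>; singular_cocycle p X A \<phi>\<rbrakk>
    \<Longrightarrow> (\<phi>, \<psi>) \<in> cohomologous p X A"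
  using cohomology_class_self equiv_cohomologous [of p X A]
  by (metis Image_singleton_iff equiv_def symD)

lemma cohomologyE:
  assumes "a \<in> cohomology p X A"
  obtains \<phi> where "singular_cocycle p X A \<phi>" "a = cohomology_class p X A \<phi>"
  using assms unfolding cohomology_def by (auto elim: quotientE)

text \<open>Operations on classes are unions over all members, so every member has to be recognised
  as a full representative of its class.\<close>

lemma cohomology_rep:
  assumes "a \<in> cohomology p X A" "\<phi> \<in> a"
  shows "singular_cocycle p X A \<phi>" "a = cohomology_class p X A \<phi>"
proof -
  obtain \<psi> where "a = cohomology_class p X A \<psi>"
    using assms cohomologyE by blast
  then have "(\<psi>, \<phi>) \<in> cohomologous p X A"
    using assms by blast
  then show "singular_cocycle p X A \<phi>" "a = cohomology_class p X A \<phi>"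
    using \<open>a = _\<close> cohomology_class_eq [of \<psi> \<phi>] by (simp_all add: cohomologous_def)
qed

lemma cohomologous_mono:
  "\<lbrakk>(\<phi>, \<psi>) \<in> cohomologous p X A; B \<subseteq> A\<rbrakk> \<Longrightarrow> (\<phi>, \<psi>) \<in> cohomologous p X B"
  by (auto simp: cohomologous_def intro: singular_cocycle_mono singular_coboundary_mono)

text \<open>Cocycles cohomologous relative to \<open>A\<close> stay so relative to the smaller
  \<open>B\<close>. Hence all terms of the union coincide, and \<open>\<phi>\<close> itself makes
  the union nonempty.\<close>

lemma cohomology_restrict_class:
  assumes "singular_cocycle p X A \<phi>" "B \<subseteq> A"
  shows "cohomology_restrict p X B (cohomology_class p X A \<phi>) = cohomology_class p X B \<phi>"
proof -
  have "cohomology_class p X B \<psi> = cohomology_class p X B \<phi>" if "\<psi> \<in> cohomology_class p X A \<phi>" for \<psi>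
  proof -
    have "(\<phi>, \<psi>) \<in> cohomologous p X B"
      using that cohomologous_mono [OF _ assms(2)] by blast
    then show ?thesis
      using cohomology_class_eq by metis
  qed
  then show ?thesis
    using cohomology_class_self [OF assms(1)] unfolding cohomology_restrict_def by blast
qed


subsection \<open>Front and back faces\<close>

lemma shift_in_standard_simplex:
  assumes "t \<in> standard_simplex q"
  shows "(\<lambda>i. if i < k then 0 else t (i - k)) \<in> standard_simplex (k + q)"
proof -
  have "(\<Sum>i\<le>k + q. if i < k then 0 else t (i - k)) = (\<Sum>i\<in>{k..k + q}. t (i - k))"
    by (rule sum.mono_neutral_cong_right) auto
  also have "\<dots> = (\<Sum>i\<le>q. t i)"
    by (rule sum.reindex_bij_witness [of _ "\<lambda>i. i + k" "\<lambda>i. i - k"]) auto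
  finally show ?thesis
    using assms by (auto simp: standard_simplex_def)
qed

lemma singular_simplex_front_face:
  assumes "singular_simplex r X \<sigma>" "p \<le> r"
  shows "singular_simplex p X (front_face p \<sigma>)"
proof -
  have "continuous_map (subtopology (powertop_real UNIV) (standard_simplex p)) X \<sigma>"
    using assms standard_simplex_mono continuous_map_from_subtopology_mono
    unfolding singular_simplex_def by blast
  then show ?thesis
    by (simp add: singular_simplex_def front_face_def)
qed

lemma singular_simplex_back_face:
  assumes "singular_simplex (k + q) X \<sigma>"
  shows "singular_simplex q X (back_face k q \<sigma>)"
proof -
  have "continuous_map (subtopology (powertop_real UNIV) (standard_simplex q)) euclideanreal
          (\<lambda>t. if i < k then 0 else t (i - k))" for i
    by (auto intro: continuous_map_from_subtopology continuous_map_product_projection)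
  then have "continuous_map (subtopology (powertop_real UNIV) (standard_simplex q))
               (subtopology (powertop_real UNIV) (standard_simplex (k + q)))
               (\<lambda>t i. if i < k then 0 else t (i - k))"
    by (auto simp: continuous_map_in_subtopology continuous_map_componentwise
             intro: shift_in_standard_simplex)
  then have "continuous_map (subtopology (powertop_real UNIV) (standard_simplex q)) X
               (\<sigma> \<circ> (\<lambda>t i. if i < k then 0 else t (i - k)))"
    using assms continuous_map_compose unfolding singular_simplex_def by blast
  then show ?thesis
    by (simp add: singular_simplex_def back_face_def o_def)
qed

text \<open>\<open>simplical_face i\<close> inserts a zero in place i, and for k < i a point of the
  k-simplex already has only zeros from there on.\<close>

lemma front_face_singular_face_above:
  assumes "k < i" "k < p"
  shows "front_face k (singular_face p i \<sigma>) = front_face k \<sigma>"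
proof -
  have "simplical_face i t = t" if "t \<in> standard_simplex k" for t :: "nat \<Rightarrow> real"
    using that assms by (auto simp: simplical_face_def standard_simplex_def fun_eq_iff)
  moreover have "standard_simplex k \<subseteq> standard_simplex (p - Suc 0)"
    using assms by (intro standard_simplex_mono) auto
  ultimately show ?thesis
    by (intro ext) (auto simp: front_face_def singular_face_def)
qed

text \<open>The range includes \<open>i = Suc k\<close>, where the preceding lemma also applies;
  comparing the two identifies the last face of the front (k+1)-face with the front k-face.\<close>

lemma front_face_singular_face_below:
  assumes "i \<le> Suc k" "k < p"
  shows "front_face k (singular_face p i \<sigma>) = singular_face (Suc k) i (front_face (Suc k) \<sigma>)"
proof -
  have "standard_simplex k \<subseteq> standard_simplex (p - Suc 0)"
    using assms by (intro standard_simplex_mono) auto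
  then show ?thesis
    using assms simplical_face_in_standard_simplex [of "Suc k" i]
    by (auto simp: front_face_def singular_face_def fun_eq_iff restrict_def)
qed

text \<open>Once a vertex v_i with i <= k is deleted, the vertices from place k on are v_(k+1),
  v_(k+2), ..., whichever i it was.\<close>

lemma back_face_singular_face_below:
  assumes "i \<le> k"
  shows "back_face k q (singular_face (Suc (k + q)) i \<sigma>) = back_face (Suc k) q \<sigma>"
proof -
  have "simplical_face i (\<lambda>i. if i < k then 0 else t (i - k)) =
          (\<lambda>i. if i < Suc k then 0 else t (i - Suc k))" for t :: "nat \<Rightarrow> real"
    using assms by (auto simp: simplical_face_def fun_eq_iff)
  then show ?thesis
    by (auto simp: back_face_def singular_face_def restrict_def shift_in_standard_simplex)
qed

text \<open>The value \<open>i = 0\<close> is included: there the deleted vertex is v_k, which the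
  preceding lemma covers too, and so the 0-th face of one back face is the next back face.\<close>

lemma back_face_singular_face_above:
  assumes "i \<le> Suc q"
  shows "back_face k q (singular_face (Suc (k + q)) (k + i) \<sigma>) =
           singular_face (Suc q) i (back_face k (Suc q) \<sigma>)"
proof -
  have "simplical_face (k + i) (\<lambda>i. if i < k then 0 else t (i - k)) =
          (\<lambda>j. if j < k then 0 else simplical_face i t (j - k))" for t :: "nat \<Rightarrow> real"
    by (auto simp: simplical_face_def fun_eq_iff)
  then show ?thesis
    using assms simplical_face_in_standard_simplex [of "Suc q" i]
    by (auto simp: back_face_def singular_face_def restrict_def shift_in_standard_simplex)
qed

lemma front_face_front_face: "p \<le> r \<Longrightarrow> front_face p (front_face r \<sigma>) = front_face p \<sigma>"
  using standard_simplex_mono [of p r] by (auto simp: front_face_def fun_eq_iff restrict_def)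

lemma back_face_back_face: "back_face k q (back_face l (k + q) \<sigma>) = back_face (l + k) q \<sigma>"
proof -
  have "(\<lambda>i. if i < l then 0 else (\<lambda>i. if i < k then 0 else t (i - k)) (i - l)) =
          (\<lambda>i. if i < l + k then 0 else t (i - (l + k)))" for t :: "nat \<Rightarrow> real"
    by (auto simp: fun_eq_iff)
  then show ?thesis
    by (auto simp: back_face_def fun_eq_iff restrict_def shift_in_standard_simplex)
qed

lemma front_face_back_face:
  "front_face k (back_face l (k + q) \<sigma>) = back_face l k (front_face (l + k) \<sigma>)"
  using standard_simplex_mono [of k "k + q"]
  by (auto simp: back_face_def front_face_def fun_eq_iff restrict_def shift_in_standard_simplex)

lemma front_face_simplex_map:
  "p \<le> r \<Longrightarrow> front_face p (simplex_map r f \<sigma>) = simplex_map p f (front_face p \<sigma>)"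
  using standard_simplex_mono [of p r]
  by (auto simp: front_face_def simplex_map_def fun_eq_iff restrict_def)

lemma back_face_simplex_map:
  "back_face k q (simplex_map (k + q) f \<sigma>) = simplex_map q f (back_face k q \<sigma>)"
  by (auto simp: back_face_def simplex_map_def fun_eq_iff restrict_def shift_in_standard_simplex)


subsection \<open>The Leibniz rules\<close>

lemma frag_cmul_diff_right: "frag_cmul k (a - b) = frag_cmul k a - frag_cmul k b"
  using frag_cmul_distrib2 [of k "a - b" b] by simp

lemma frag_cmul_sum_left: "frag_cmul (\<Sum>i\<in>I. f i) a = (\<Sum>i\<in>I. frag_cmul (f i) a)"
  by (induction I rule: infinite_finite_induct) (auto simp: frag_cmul_distrib)

lemma chain_cap_0 [simp]: "chain_cap k q 0 \<phi> = 0"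
  by (simp add: chain_cap_def)

lemma chain_cap_of [simp]:
  "chain_cap k q (frag_of \<sigma>) \<phi> = frag_cmul (\<phi> (front_face k \<sigma>)) (frag_of (back_face k q \<sigma>))"
  by (simp add: chain_cap_def)

lemma chain_cap_add: "chain_cap k q (a + b) \<phi> = chain_cap k q a \<phi> + chain_cap k q b \<phi>"
  by (simp add: chain_cap_def frag_extend_add)

lemma chain_cap_diff: "chain_cap k q (a - b) \<phi> = chain_cap k q a \<phi> - chain_cap k q b \<phi>"
  by (simp add: chain_cap_def frag_extend_diff)

lemma chain_cap_cmul: "chain_cap k q (frag_cmul m a) \<phi> = frag_cmul m (chain_cap k q a \<phi>)"
  by (simp add: chain_cap_def frag_extend_cmul)

lemma chain_cap_sum: "chain_cap k q (\<Sum>i\<in>I. f i) \<phi> = (\<Sum>i\<in>I. chain_cap k q (f i) \<phi>)"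
  by (induction I rule: infinite_finite_induct) (auto simp: chain_cap_add)

lemma chain_cap_cochain_diff:
  "chain_cap k q c (\<lambda>\<sigma>. \<phi> \<sigma> - \<psi> \<sigma>) = chain_cap k q c \<phi> - chain_cap k q c \<psi>"
  by (simp add: chain_cap_def frag_extend_def frag_cmul_diff_distrib frag_cmul_diff_right
      flip: sum_subtractf frag_cmul_cmul)

lemma chain_cap_zero [simp]: "chain_cap k q c (\<lambda>\<sigma>. 0) = 0"
  by (simp add: chain_cap_def frag_extend_def)

lemma singular_chain_cap:
  assumes "singular_chain (k + q) X c"
  shows "singular_chain q X (chain_cap k q c \<phi>)"
  using assms unfolding chain_cap_def singular_chain_def [of "k + q"]
  by (intro singular_chain_extend singular_chain_cmul)
     (auto simp: singular_chain_of intro: singular_simplex_back_face)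

lemma chain_cap_vanishes:
  assumes "singular_chain (k + q) (subtopology X A) c" "singular_cochain k X A \<phi>"
  shows "chain_cap k q c \<phi> = 0"
proof -
  have "\<phi> (front_face k \<sigma>) = 0" if "\<sigma> \<in> Poly_Mapping.keys c" for \<sigma>
  proof -
    have "singular_simplex k (subtopology X A) (front_face k \<sigma>)"
      using assms that singular_simplex_front_face [of "k + q" "subtopology X A" \<sigma> k]
      unfolding singular_chain_def by auto
    then show ?thesis
      using assms by (simp add: singular_cochain_def)
  qed
  then show ?thesis
    by (simp add: chain_cap_def frag_extend_def)
qed

text \<open>Faces deleting one of v_0, ..., v_k change the front part and leave the back part alone;
  the remaining faces do the opposite. The first group lacks one face of the front (k+1)-face, and
  the second lacks one face of the back (q+1)-face. The two missing terms are multiples of the same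
  simplex with opposite signs, so both can be added.\<close>

lemma chain_cap_chain_boundary:
  assumes "singular_chain (Suc (k + q)) X c"
  shows "chain_cap k q (chain_boundary (Suc (k + q)) c) \<phi> =
           chain_cap (Suc k) q c (cochain_coboundary k X \<phi>) +
           frag_cmul ((-1) ^ k) (chain_boundary (Suc q) (chain_cap k (Suc q) c \<phi>))"
  using assms unfolding singular_chain_def
proof (induction c rule: frag_induction)
  case (one \<sigma>)
  then have \<sigma>: "singular_simplex (Suc (k + q)) X \<sigma>"
    by simp
  define F where "F = front_face (Suc k) \<sigma>"
  define f where "f = front_face k \<sigma>"
  define B where "B = back_face k (Suc q) \<sigma>"
  define b where "b = back_face (Suc k) q \<sigma>"
  have F: "singular_simplex (Suc k) X F"
    unfolding F_def using \<sigma> by (rule singular_simplex_front_face) simp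
  have fF: "singular_face (Suc k) (Suc k) F = f"
    using front_face_singular_face_below [of "Suc k" k "Suc (Suc k)" \<sigma>]
      front_face_singular_face_above [of k "Suc k" "Suc (Suc k)" \<sigma>]
    by (simp add: F_def f_def)
  have bB: "singular_face (Suc q) 0 B = b"
    using back_face_singular_face_above [of 0 q k \<sigma>] back_face_singular_face_below [of k k q \<sigma>]
    by (simp add: B_def b_def)
  have cap: "chain_cap k q (frag_of (singular_face (Suc (k + q)) i \<sigma>)) \<phi> =
      (if i \<le> k then frag_cmul (\<phi> (singular_face (Suc k) i F)) (frag_of b)
       else frag_cmul (\<phi> f) (frag_of (singular_face (Suc q) (i - k) B)))"
    if "i \<le> Suc (k + q)" for i
  proof (cases "i \<le> k")
    case True
    then show ?thesis
      by (simp add: front_face_singular_face_below back_face_singular_face_below F_def b_def)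
  next
    case False
    then show ?thesis
      using that back_face_singular_face_above [of "i - k" q k \<sigma>]
      by (simp add: front_face_singular_face_above f_def B_def)
  qed
  \<comment> \<open>The second sum is indexed by the face number of \<open>B\<close>. It starts at 1
    because face 0 of \<open>B\<close> comes from deleting v_k, which belongs to the first
    group.\<close>
  have split: "(\<Sum>i\<le>Suc (k + q). g i) = (\<Sum>i\<le>k. g i) + (\<Sum>j\<in>{1..Suc q}. g (j + k))"
    for g :: "nat \<Rightarrow> 'a chain"
  proof -
    have "{..Suc (k + q)} = {..k} \<union> {1 + k..Suc q + k}" "{..k} \<inter> {1 + k..Suc q + k} = {}"
      by auto
    then show ?thesis
      unfolding sum.shift_bounds_cl_nat_ivl [symmetric] by (simp add: sum.union_disjoint)
  qed
  have "chain_cap k q (chain_boundary (Suc (k + q)) (frag_of \<sigma>)) \<phi> =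
          (\<Sum>i\<le>Suc (k + q). frag_cmul ((-1) ^ i)
             (chain_cap k q (frag_of (singular_face (Suc (k + q)) i \<sigma>)) \<phi>))"
    by (simp add: chain_boundary_of chain_cap_sum chain_cap_cmul del: sum.atMost_Suc chain_cap_of)
  also have "\<dots> = (\<Sum>i\<le>k. frag_cmul ((-1) ^ i * \<phi> (singular_face (Suc k) i F)) (frag_of b)) +
      (\<Sum>j\<in>{1..Suc q}. frag_cmul ((-1) ^ (j + k) * \<phi> f) (frag_of (singular_face (Suc q) j B)))"
    (is "_ = ?L + ?R")
    unfolding split by (auto simp: cap simp del: chain_cap_of intro!: arg_cong2 [of _ _ _ _ "(+)"] sum.cong)
  \<comment> \<open>Face \<open>Suc k\<close> of \<open>F\<close> is \<open>f\<close>. Completing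
    the coboundary by this term, of sign (-1)^(k+1), is paid for by the extra summand, which cancels
    against the one split off from \<open>?R\<close>.\<close>
  also have "?L = frag_cmul (cochain_eval \<phi> (chain_boundary (Suc k) (frag_of F))) (frag_of b)
                    + frag_cmul ((-1) ^ k * \<phi> f) (frag_of b)"
    unfolding cochain_eval_boundary_of using fF
    by (simp flip: frag_cmul_distrib frag_cmul_sum_left)
  also have "?R = frag_cmul ((-1) ^ k * \<phi> f) (chain_boundary (Suc q) (frag_of B))
                    - frag_cmul ((-1) ^ k * \<phi> f) (frag_of b)"
  proof -
    have "{..Suc q} = insert 0 {1..Suc q}"
      by auto
    then have "chain_boundary (Suc q) (frag_of B) =
        frag_of b + (\<Sum>j\<in>{1..Suc q}. frag_cmul ((-1) ^ j) (frag_of (singular_face (Suc q) j B)))"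
      using bB by (simp add: chain_boundary_of del: sum.atMost_Suc)
    then show ?thesis
      by (simp add: frag_cmul_distrib2 frag_cmul_sum power_add mult_ac)
  qed
  finally have "chain_cap k q (chain_boundary (Suc (k + q)) (frag_of \<sigma>)) \<phi> =
      frag_cmul (cochain_eval \<phi> (chain_boundary (Suc k) (frag_of F))) (frag_of b) +
      frag_cmul ((-1) ^ k * \<phi> f) (chain_boundary (Suc q) (frag_of B))"
    by simp
  moreover have "chain_cap (Suc k) q (frag_of \<sigma>) (cochain_coboundary k X \<phi>) =
      frag_cmul (cochain_eval \<phi> (chain_boundary (Suc k) (frag_of F))) (frag_of b)"
    using F by (simp add: F_def b_def cochain_coboundary_def)
  moreover have "chain_boundary (Suc q) (chain_cap k (Suc q) (frag_of \<sigma>) \<phi>) =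
      frag_cmul (\<phi> f) (chain_boundary (Suc q) (frag_of B))"
    by (simp add: f_def B_def chain_boundary_cmul)
  ultimately show ?case
    by (simp only: frag_cmul_cmul)
next
  case (diff a b)
  then show ?case
    by (simp add: chain_cap_diff chain_boundary_diff frag_cmul_diff_right)
qed auto

text \<open>Cup and cap are adjoint under evaluation, so the Leibniz rule for cochains follows from
  the one for chains.\<close>

lemma cochain_eval_cup:
  assumes "singular_chain (p + q) X c"
  shows "cochain_eval (cochain_cup p q X \<phi> \<psi>) c = cochain_eval \<psi> (chain_cap p q c \<phi>)"
  using assms unfolding singular_chain_def
proof (induction c rule: frag_induction)
  case (one \<sigma>)
  then show ?case
    by (simp add: cochain_cup_def cochain_eval_cmul)
next
  case (diff a b)
  then show ?case
    by (simp add: cochain_eval_diff chain_cap_diff)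
qed auto

lemma cochain_coboundary_cup:
  "cochain_coboundary (p + q) X (cochain_cup p q X \<phi> \<psi>) =
     (\<lambda>\<sigma>. cochain_cup (Suc p) q X (cochain_coboundary p X \<phi>) \<psi> \<sigma> +
          (-1) ^ p * cochain_cup p (Suc q) X \<phi> (cochain_coboundary q X \<psi>) \<sigma>)"
proof
  fix \<sigma>
  show "cochain_coboundary (p + q) X (cochain_cup p q X \<phi> \<psi>) \<sigma> =
     cochain_cup (Suc p) q X (cochain_coboundary p X \<phi>) \<psi> \<sigma> +
          (-1) ^ p * cochain_cup p (Suc q) X \<phi> (cochain_coboundary q X \<psi>) \<sigma>"
  proof (cases "singular_simplex (Suc (p + q)) X \<sigma>")
    case True
    let ?c = "frag_of \<sigma>"
    have c: "singular_chain (Suc (p + q)) X ?c"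
      using True by (simp add: singular_chain_of)
    then have "singular_chain (p + q) X (chain_boundary (Suc (p + q)) ?c)"
      by (rule singular_chain_boundary_alt)
    then have "cochain_coboundary (p + q) X (cochain_cup p q X \<phi> \<psi>) \<sigma> =
        cochain_eval \<psi> (chain_cap p q (chain_boundary (Suc (p + q)) ?c) \<phi>)"
      using True by (simp add: cochain_coboundary_def cochain_eval_cup)
    also have "\<dots> = cochain_eval \<psi> (chain_cap (Suc p) q ?c (cochain_coboundary p X \<phi>)) +
        (-1) ^ p * cochain_eval \<psi> (chain_boundary (Suc q) (chain_cap p (Suc q) ?c \<phi>))"
      unfolding chain_cap_chain_boundary [OF c]
      by (simp add: cochain_eval_add cochain_eval_cmul del: chain_cap_of)
    also have "cochain_eval \<psi> (chain_boundary (Suc q) (chain_cap p (Suc q) ?c \<phi>)) =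
        cochain_eval (cochain_cup p (Suc q) X \<phi> (cochain_coboundary q X \<psi>)) ?c"
      using c by (simp add: cochain_eval_cup cochain_eval_coboundary singular_chain_cap del: chain_cap_of cochain_eval_of)
    also have "cochain_eval \<psi> (chain_cap (Suc p) q ?c (cochain_coboundary p X \<phi>)) =
        cochain_eval (cochain_cup (Suc p) q X (cochain_coboundary p X \<phi>) \<psi>) ?c"
      using c by (simp add: cochain_eval_cup del: chain_cap_of cochain_eval_of)
    finally show ?thesis
      by simp
  qed (simp add: cochain_coboundary_def cochain_cup_def)
qed

text \<open>Simplexwise this only rearranges iterated front and back faces. It permits capping with
  the step cocycle alone before the classes of \<open>M\<close> enter.\<close>

lemma chain_cap_cup:
  assumes "singular_chain (p + r + q) X c"
  shows "chain_cap (p + r) q c (cochain_cup p r X \<phi> \<psi>) =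
           chain_cap r q (chain_cap p (r + q) c \<phi>) \<psi>"
  using assms unfolding singular_chain_def
proof (induction c rule: frag_induction)
  case (one \<sigma>)
  then have "singular_simplex (p + r) X (front_face (p + r) \<sigma>)"
    by (auto intro: singular_simplex_front_face)
  then show ?case
    by (simp add: cochain_cup_def chain_cap_cmul front_face_front_face front_face_back_face
        back_face_back_face)
next
  case (diff a b)
  then show ?case
    by (simp add: chain_cap_diff)
qed auto


subsection \<open>Products of classes\<close>

text \<open>The first factor is evaluated on a front face, and a simplex in \<open>A\<close> has its
  front faces in \<open>A\<close>; relative vanishing is therefore inherited from the first
  factor.\<close>

lemma singular_cochain_cup:
  assumes "singular_cochain p X A \<phi>"
  shows "singular_cochain (p + q) X A (cochain_cup p q X \<phi> \<psi>)"
  using assms singular_simplex_front_face [of "p + q" "subtopology X A" _ p]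
  by (auto simp: singular_cochain_def cochain_cup_def)

lemma cochain_cup_zero_left [simp]: "cochain_cup p q X (\<lambda>\<sigma>. 0) \<psi> = (\<lambda>\<sigma>. 0)"
  and cochain_cup_zero_right [simp]: "cochain_cup p q X \<phi> (\<lambda>\<sigma>. 0) = (\<lambda>\<sigma>. 0)"
  by (auto simp: cochain_cup_def)

lemma cochain_cup_diff_left:
  "cochain_cup p q X (\<lambda>\<sigma>. \<phi> \<sigma> - \<phi>' \<sigma>) \<psi> =
     (\<lambda>\<sigma>. cochain_cup p q X \<phi> \<psi> \<sigma> - cochain_cup p q X \<phi>' \<psi> \<sigma>)"
  by (auto simp: cochain_cup_def left_diff_distrib)

lemma cochain_cup_diff_right:
  "cochain_cup p q X \<phi> (\<lambda>\<sigma>. \<psi> \<sigma> - \<psi>' \<sigma>) =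
     (\<lambda>\<sigma>. cochain_cup p q X \<phi> \<psi> \<sigma> - cochain_cup p q X \<phi> \<psi>' \<sigma>)"
  by (auto simp: cochain_cup_def right_diff_distrib)

lemma singular_cocycle_cup:
  assumes "singular_cocycle p X A \<phi>" "singular_cocycle q X {} \<psi>"
  shows "singular_cocycle (p + q) X A (cochain_cup p q X \<phi> \<psi>)"
  using assms by (simp add: singular_cocycle_def singular_cochain_cup cochain_coboundary_cup)

lemma singular_coboundary_cup_left:
  assumes "singular_coboundary p X A \<phi>" "singular_cocycle q X {} \<psi>"
  shows "singular_coboundary (p + q) X A (cochain_cup p q X \<phi> \<psi>)"
proof (cases p)
  case 0
  then show ?thesis
    using assms by (simp add: singular_coboundary_0_iff)
next
  case (Suc r)
  then obtain \<eta> where \<eta>: "singular_cochain r X A \<eta>" "\<phi> = cochain_coboundary r X \<eta>"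
    using assms singular_coboundary_Suc by blast
  then have "cochain_cup p q X \<phi> \<psi> = cochain_coboundary (r + q) X (cochain_cup r q X \<eta> \<psi>)"
    using assms by (simp add: Suc cochain_coboundary_cup singular_cocycle_def)
  then show ?thesis
    using \<eta> singular_cochain_cup [of r X A \<eta> q \<psi>]
    by (auto simp: Suc singular_coboundary_Suc)
qed

lemma singular_coboundary_cup_right:
  assumes "singular_cocycle p X A \<phi>" "singular_coboundary q X {} \<psi>"
  shows "singular_coboundary (p + q) X A (cochain_cup p q X \<phi> \<psi>)"
proof (cases q)
  case 0
  then show ?thesis
    using assms by (simp add: singular_coboundary_0_iff)
next
  case (Suc r)
  then obtain \<eta> where \<eta>: "\<psi> = cochain_coboundary r X \<eta>"
    using assms singular_coboundary_Suc by blast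
  have "singular_coboundary (Suc (p + r)) X A (cochain_coboundary (p + r) X (cochain_cup p r X \<phi> \<eta>))"
    using assms singular_cochain_cup [of p X A \<phi> r \<eta>]
    by (auto simp: singular_coboundary_Suc singular_cocycle_def)
  \<comment> \<open>Leibniz yields the product up to the sign (-1)^p, which is removed by scaling
    with the same sign.\<close>
  then have "singular_coboundary (Suc (p + r)) X A
               (\<lambda>\<sigma>. (-1) ^ p * cochain_coboundary (p + r) X (cochain_cup p r X \<phi> \<eta>) \<sigma>)"
    by (rule singular_coboundary_mult)
  also have "(\<lambda>\<sigma>. (-1) ^ p * cochain_coboundary (p + r) X (cochain_cup p r X \<phi> \<eta>) \<sigma>) =
      cochain_cup p q X \<phi> \<psi>"
    using assms
    by (simp add: Suc \<eta> cochain_coboundary_cup singular_cocycle_def flip: mult.assoc power_mult_distrib)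
  finally show ?thesis
    by (simp add: Suc)
qed

lemma cohomologous_cup:
  assumes "(\<phi>, \<phi>') \<in> cohomologous p X A" "(\<psi>, \<psi>') \<in> cohomologous q X {}"
  shows "(cochain_cup p q X \<phi> \<psi>, cochain_cup p q X \<phi>' \<psi>') \<in> cohomologous (p + q) X A"
proof -
  have "(cochain_cup p q X \<phi> \<psi>, cochain_cup p q X \<phi>' \<psi>) \<in> cohomologous (p + q) X A"
    using assms singular_coboundary_cup_left [of p X A "\<lambda>\<sigma>. \<phi> \<sigma> - \<phi>' \<sigma>" q \<psi>]
    by (simp add: cohomologous_def singular_cocycle_cup cochain_cup_diff_left)
  moreover have "(cochain_cup p q X \<phi>' \<psi>, cochain_cup p q X \<phi>' \<psi>') \<in> cohomologous (p + q) X A"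
    using assms singular_coboundary_cup_right [of p X A \<phi>' q "\<lambda>\<sigma>. \<psi> \<sigma> - \<psi>' \<sigma>"]
    by (simp add: cohomologous_def singular_cocycle_cup cochain_cup_diff_right)
  ultimately show ?thesis
    using equiv_cohomologous [of "p + q" X A] by (meson equiv_def transD)
qed

lemma cup_class:
  assumes "singular_cocycle p X A \<phi>" "singular_cocycle q X {} \<psi>"
  shows "cup p q X A (cohomology_class p X A \<phi>) (cohomology_class q X {} \<psi>) =
           cohomology_class (p + q) X A (cochain_cup p q X \<phi> \<psi>)"
proof -
  have "cohomology_class (p + q) X A (cochain_cup p q X \<phi>' \<psi>') =
          cohomology_class (p + q) X A (cochain_cup p q X \<phi> \<psi>)"
    if "\<phi>' \<in> cohomology_class p X A \<phi>" "\<psi>' \<in> cohomology_class q X {} \<psi>" for \<phi>' \<psi>'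
    using that by (intro cohomology_class_eq [symmetric] cohomologous_cup) auto
  then show ?thesis
    using cohomology_class_self [OF assms(1)] cohomology_class_self [OF assms(2)]
    unfolding cup_def by blast
qed

lemma singular_cocycle_unit:
  "singular_cocycle 0 X {} (\<lambda>\<sigma>. if singular_simplex 0 X \<sigma> then 1 else 0)"
proof -
  have "cochain_coboundary 0 X (\<lambda>\<sigma>. if singular_simplex 0 X \<sigma> then 1 else 0) \<sigma> = 0" for \<sigma>
    using singular_simplex_singular_face [of "Suc 0" X \<sigma> 0]
      singular_simplex_singular_face [of "Suc 0" X \<sigma> "Suc 0"]
    by (simp add: cochain_coboundary_def cochain_eval_boundary_of)
  then show ?thesis
    by (auto simp: singular_cocycle_def singular_cochain_def singular_simplex_empty)
qed

text \<open>A cochain-level companion of \<open>cup_list\<close>: with representatives fixed,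
  compatibility with pullback is an equality of cochains.\<close>

fun cochain_cup_list :: "'a topology \<Rightarrow> 'a cochain list \<Rightarrow> 'a cochain" where
  "cochain_cup_list X [] = (\<lambda>\<sigma>. if singular_simplex 0 X \<sigma> then 1 else 0)"
| "cochain_cup_list X (\<phi> # \<phi>s) = cochain_cup 1 (length \<phi>s) X \<phi> (cochain_cup_list X \<phi>s)"

lemma singular_cocycle_cup_list:
  assumes "\<And>\<phi>. \<phi> \<in> set \<phi>s \<Longrightarrow> singular_cocycle 1 X {} \<phi>"
  shows "singular_cocycle (length \<phi>s) X {} (cochain_cup_list X \<phi>s)"
  using assms
proof (induction \<phi>s)
  case Nil
  then show ?case
    by (simp add: singular_cocycle_unit)
next
  case (Cons \<phi> \<phi>s)
  then show ?case
    using singular_cocycle_cup [of 1 X "{}" \<phi> "length \<phi>s"] by simp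
qed

lemma cup_list_class:
  assumes "\<And>\<phi>. \<phi> \<in> set \<phi>s \<Longrightarrow> singular_cocycle 1 X {} \<phi>"
  shows "cup_list X (map (cohomology_class 1 X {}) \<phi>s) =
           cohomology_class (length \<phi>s) X {} (cochain_cup_list X \<phi>s)"
  using assms
proof (induction \<phi>s)
  case Nil
  then show ?case
    by (simp add: cohomology_unit_def)
next
  case (Cons \<phi> \<phi>s)
  then show ?case
    using cup_class [of 1 X "{}" \<phi> "length \<phi>s"] by (simp add: singular_cocycle_cup_list)
qed

lemma cohomology_list_reps:
  assumes "set bs \<subseteq> cohomology p X A"
  obtains \<phi>s where "bs = map (cohomology_class p X A) \<phi>s"
    "\<And>\<phi>. \<phi> \<in> set \<phi>s \<Longrightarrow> singular_cocycle p X A \<phi>"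
proof -
  have "\<exists>\<phi>s. bs = map (cohomology_class p X A) \<phi>s \<and> (\<forall>\<phi>\<in>set \<phi>s. singular_cocycle p X A \<phi>)"
    using assms
  proof (induction bs)
    case (Cons b bs)
    then obtain \<phi>s where "bs = map (cohomology_class p X A) \<phi>s" "\<forall>\<phi>\<in>set \<phi>s. singular_cocycle p X A \<phi>"
      by auto
    moreover obtain \<phi> where "singular_cocycle p X A \<phi>" "b = cohomology_class p X A \<phi>"
      using Cons.prems cohomologyE [of b p X A] by auto
    ultimately show ?case
      by (intro exI [of _ "\<phi> # \<phi>s"]) auto
  qed auto
  then show ?thesis
    using that by blast
qed

section \<open>Cap products on homology classes\<close>

lemma singular_relboundary_cap:
  assumes "singular_relboundary (k + q) X A c" "singular_cocycle k X A \<phi>"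
  shows "singular_relboundary q X {} (chain_cap k q c \<phi>)"
proof -
  obtain d e where d: "singular_chain (Suc (k + q)) X d"
    and e: "singular_chain (k + q) (subtopology X A) e" and c: "c = chain_boundary (Suc (k + q)) d + e"
    using assms by (auto simp: singular_relboundary)
  \<comment> \<open>The summand in \<open>A\<close> is killed because \<open>\<phi>\<close> vanishes
    there. This is why a boundary relative to \<open>A\<close> becomes an absolute boundary.\<close>
  have "chain_cap k q c \<phi> = chain_cap k q (chain_boundary (Suc (k + q)) d) \<phi>"
    using assms e by (simp add: c chain_cap_add chain_cap_vanishes singular_cocycle_def)
  also have "\<dots> = frag_cmul ((-1) ^ k) (chain_boundary (Suc q) (chain_cap k (Suc q) d \<phi>))"
    using assms d by (simp add: chain_cap_chain_boundary singular_cocycle_def)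
  finally have "chain_boundary (Suc q) (frag_cmul ((-1) ^ k) (chain_cap k (Suc q) d \<phi>)) = chain_cap k q c \<phi>"
    by (simp add: chain_boundary_cmul)
  moreover have "singular_chain (Suc q) X (frag_cmul ((-1) ^ k) (chain_cap k (Suc q) d \<phi>))"
    using d by (simp add: singular_chain_cmul singular_chain_cap)
  ultimately show ?thesis
    using singular_boundary by blast
qed

text \<open>Leibniz for \<open>\<eta>\<close>: the boundary of \<open>c\<close> lies in
  \<open>A\<close>, where \<open>\<eta>\<close> vanishes, so capping with the coboundary of
  \<open>\<eta>\<close> gives a boundary up to sign.\<close>

lemma singular_relboundary_cap_coboundary:
  assumes "singular_relcycle (k + q) X A c" "singular_coboundary k X A \<phi>"
  shows "singular_relboundary q X {} (chain_cap k q c \<phi>)"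
proof (cases k)
  case 0
  then show ?thesis
    using assms by (simp add: singular_coboundary_0_iff)
next
  case (Suc r)
  then obtain \<eta> where \<eta>: "singular_cochain r X A \<eta>" "\<phi> = cochain_coboundary r X \<eta>"
    using assms singular_coboundary_Suc by blast
  have c: "singular_chain (Suc (r + q)) X c"
    and "singular_chain (r + q) (subtopology X A) (chain_boundary (Suc (r + q)) c)"
    using assms by (auto simp: Suc singular_relcycle)
  then have "chain_cap r q (chain_boundary (Suc (r + q)) c) \<eta> = 0"
    using \<eta> chain_cap_vanishes by blast
  then have "chain_cap k q c \<phi> = - frag_cmul ((-1) ^ r) (chain_boundary (Suc q) (chain_cap r (Suc q) c \<eta>))"
    unfolding chain_cap_chain_boundary [OF c] \<eta> Suc by (simp add: add_eq_0_iff2)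
  moreover have "singular_relboundary q X {} (chain_boundary (Suc q) (chain_cap r (Suc q) c \<eta>))"
    using singular_chain_cap [of r "Suc q" X c \<eta>] c by (auto simp: singular_boundary)
  ultimately show ?thesis
    by (simp add: singular_relboundary_cmul singular_relboundary_minus)
qed

lemma homologous_rel_cap:
  assumes "homologous_rel (k + q) X A c d" "singular_relcycle (k + q) X A c"
    and "(\<phi>, \<psi>) \<in> cohomologous k X A"
  shows "homologous_rel q X {} (chain_cap k q c \<phi>) (chain_cap k q d \<psi>)"
proof -
  have "homologous_rel q X {} (chain_cap k q c \<phi>) (chain_cap k q c \<psi>)"
    using assms singular_relboundary_cap_coboundary [of k q X A c "\<lambda>\<sigma>. \<phi> \<sigma> - \<psi> \<sigma>"]
    by (simp add: homologous_rel_def cohomologous_def chain_cap_cochain_diff)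
  moreover have "homologous_rel q X {} (chain_cap k q c \<psi>) (chain_cap k q d \<psi>)"
    using assms singular_relboundary_cap [of k q X A "c - d" \<psi>]
    by (simp add: homologous_rel_def cohomologous_def chain_cap_diff)
  ultimately show ?thesis
    using homologous_rel_trans by blast
qed

lemma singular_cycle_cap:
  assumes "singular_relcycle (k + q) X A c" "singular_cocycle k X A \<phi>"
  shows "singular_relcycle q X {} (chain_cap k q c \<phi>)"
proof (cases q)
  case 0
  then show ?thesis
    using assms singular_chain_cap [of k q X c \<phi>]
    by (simp add: singular_relcycle singular_cycle chain_boundary_def)
next
  case (Suc r)
  have c: "singular_chain (Suc (k + r)) X c"
    and "singular_chain (k + r) (subtopology X A) (chain_boundary (Suc (k + r)) c)"
    using assms by (auto simp: Suc singular_relcycle)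
  then have "chain_cap k r (chain_boundary (Suc (k + r)) c) \<phi> = 0"
    using assms chain_cap_vanishes unfolding singular_cocycle_def by blast
  then have "frag_cmul ((-1) ^ k) (chain_boundary (Suc r) (chain_cap k (Suc r) c \<phi>)) = 0"
    unfolding chain_cap_chain_boundary [OF c] using assms by (simp add: singular_cocycle_def)
  then show ?thesis
    using c singular_chain_cap [of k "Suc r" X c \<phi>] by (simp add: Suc singular_cycle)
qed

lemma cap_class:
  assumes "singular_relcycle (k + q) X {} c" "singular_cocycle k X {} \<phi>"
  shows "cap k q X (homologous_rel_set (k + q) X {} c) (cohomology_class k X {} \<phi>) =
           homologous_rel_set q X {} (chain_cap k q c \<phi>)"
proof -
  have "homologous_rel_set q X {} (chain_cap k q d \<psi>) = homologous_rel_set q X {} (chain_cap k q c \<phi>)"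
    if "d \<in> homologous_rel_set (k + q) X {} c" "\<psi> \<in> cohomology_class k X {} \<phi>" for d \<psi>
  proof -
    have "homologous_rel q X {} (chain_cap k q c \<phi>) (chain_cap k q d \<psi>)"
      by (rule homologous_rel_cap) (use that assms in auto)
    then show ?thesis
      by (metis homologous_rel_set_eq)
  qed
  moreover have "c \<in> homologous_rel_set (k + q) X {} c"
    by simp
  ultimately show ?thesis
    using cohomology_class_self [OF assms(2)] unfolding cap_def by blast
qed


subsection \<open>Limits and colimits over the ends\<close>

lemma lim_homologous_sym:
  assumes "(c, d) \<in> lim_homologous p X W"
  shows "(d, c) \<in> lim_homologous p X W"
proof -
  obtain e where e: "lim_chain (Suc p) X W e"
    and h: "\<And>i. singular_chain p (subtopology X (W i)) (c i - d i - chain_boundary (Suc p) (e i))"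
    and cd: "lim_cycle p X W c" "lim_cycle p X W d"
    using assms by (auto simp: lim_homologous_def)
  have "lim_chain (Suc p) X W (\<lambda>i. - e i)"
    using e singular_chain_minus by (auto simp: lim_chain_def) (metis minus_diff_commute minus_diff_eq singular_chain_minus)
  moreover have "singular_chain p (subtopology X (W i)) (d i - c i - chain_boundary (Suc p) (- e i))" for i
    using h [of i] singular_chain_minus [of p "subtopology X (W i)" "c i - d i - chain_boundary (Suc p) (e i)"]
    by (simp add: chain_boundary_minus algebra_simps)
  ultimately show ?thesis
    using cd unfolding lim_homologous_def by blast
qed

lemma lim_homologous_trans:
  assumes "(a, b) \<in> lim_homologous p X W" "(b, c) \<in> lim_homologous p X W"
  shows "(a, c) \<in> lim_homologous p X W"
proof -
  obtain e f where e: "lim_chain (Suc p) X W e" "lim_chain (Suc p) X W f"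
    and h: "\<And>i. singular_chain p (subtopology X (W i)) (a i - b i - chain_boundary (Suc p) (e i))"
      "\<And>i. singular_chain p (subtopology X (W i)) (b i - c i - chain_boundary (Suc p) (f i))"
    and ac: "lim_cycle p X W a" "lim_cycle p X W c"
    using assms by (auto simp: lim_homologous_def)
  have "lim_chain (Suc p) X W (\<lambda>i. e i + f i)"
    using e by (simp add: lim_chain_def singular_chain_add add_diff_add)
  moreover have "singular_chain p (subtopology X (W i)) (a i - c i - chain_boundary (Suc p) (e i + f i))" for i
    using singular_chain_add [OF h(1) [of i] h(2) [of i]] by (simp add: chain_boundary_add algebra_simps)
  ultimately show ?thesis
    using ac unfolding lim_homologous_def by blast
qed

lemma lim_homologous_refl:
  assumes "lim_cycle p X W c"
  shows "(c, c) \<in> lim_homologous p X W"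
proof -
  have "lim_chain (Suc p) X W (\<lambda>i. 0)"
    by (simp add: lim_chain_def)
  then show ?thesis
    using assms unfolding lim_homologous_def by force
qed

lemma lim_class_eq:
  assumes "(c, d) \<in> lim_homologous p X W"
  shows "lim_homologous p X W `` {c} = lim_homologous p X W `` {d}"
  using assms lim_homologous_sym lim_homologous_trans by blast

lemma lim_homologous_imp_homologous_rel:
  assumes "(c, d) \<in> lim_homologous p X W"
  shows "homologous_rel p X (W i) (c i) (d i)"
proof -
  obtain e where "lim_chain (Suc p) X W e"
    and h: "singular_chain p (subtopology X (W i)) (c i - d i - chain_boundary (Suc p) (e i))"
    using assms by (auto simp: lim_homologous_def)
  then have "singular_chain (Suc p) X (e i)"
    by (simp add: lim_chain_def)
  then show ?thesis
    using h unfolding homologous_rel_def singular_relboundary by force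
qed

lemma lim_proj_class:
  assumes "lim_cycle p X W c"
  shows "lim_proj p X W i (lim_homologous p X W `` {c}) = homologous_rel_set p X (W i) (c i)"
proof -
  have "homologous_rel_set p X (W i) (d i) = homologous_rel_set p X (W i) (c i)"
    if "(c, d) \<in> lim_homologous p X W" for d
    using lim_homologous_imp_homologous_rel [OF that] by (metis homologous_rel_set_eq)
  then show ?thesis
    using lim_homologous_refl [OF assms] unfolding lim_proj_def by blast
qed

text \<open>Only the zero chain lives on the empty set, so for empty \<open>W\<close> the limit
  complex consists of constant sequences, that is, of ordinary chains.\<close>

lemma lim_cycle_const:
  "singular_relcycle p X {} c \<Longrightarrow> lim_cycle p X (\<lambda>i. {}) (\<lambda>i. c)"
  by (simp add: lim_cycle_def lim_chain_def singular_cycle)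

lemma lim_homologous_const:
  assumes "homologous_rel p X {} c d" "singular_relcycle p X {} c"
  shows "(\<lambda>i. c, \<lambda>i. d) \<in> lim_homologous p X (\<lambda>i. {})"
proof -
  obtain e where e: "singular_chain (Suc p) X e" "chain_boundary (Suc p) e = c - d"
    using assms by (auto simp: homologous_rel_def singular_boundary)
  have "lim_chain (Suc p) X (\<lambda>i. {}) (\<lambda>i. e)"
    using e by (simp add: lim_chain_def)
  moreover have "singular_relcycle p X {} d"
    using assms homologous_rel_singular_relcycle by blast
  ultimately show ?thesis
    using assms e unfolding lim_homologous_def by (auto intro!: lim_cycle_const exI [of _ "\<lambda>i. e"])
qed

text \<open>Telescoping: since \<open>W\<close> decreases, each of the successive differences from
  stage i on lies in \<open>W i\<close>.\<close>

lemma lim_chain_add: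
  assumes "lim_chain p X W c" "antimono W" "i \<le> m"
  shows "singular_chain p (subtopology X (W i)) (c m - c i)"
  using \<open>i \<le> m\<close>
proof (induction m rule: dec_induct)
  case (step m)
  have "singular_chain p (subtopology X (W i)) (c (Suc m) - c m)"
    using assms step antimonoD [OF assms(2), of i m] singular_chain_mono
    unfolding lim_chain_def by blast
  then show ?case
    using singular_chain_add [OF _ step.IH] by fastforce
qed simp

section \<open>Classes in the colimit and their representatives\<close>

lemma colim_pairs_class:
  "singular_cocycle p X (W i) \<phi> \<Longrightarrow> (i, cohomology_class p X (W i) \<phi>) \<in> colim_pairs p X W"
  by (simp add: colim_pairs_def cohomology_class_in)

lemma colim_rel_nonempty:
  assumes "((i, a), (j, b)) \<in> colim_rel p X W"
  obtains \<xi> where "\<xi> \<in> b"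
proof -
  have "b \<in> cohomology p X (W j)"
    using assms by (simp add: colim_rel_def colim_pairs_def)
  then show ?thesis
    using that cohomology_class_self by (elim cohomologyE) blast
qed

text \<open>A colimit class contains pairs from all stages, with arbitrary representatives. This
  extracts from any such pair a later stage at which its representative can be compared with the
  chosen cocycle.\<close>

lemma colim_relD:
  assumes "((i, cohomology_class p X (W i) \<phi>), (j, b)) \<in> colim_rel p X W"
    and "singular_cocycle p X (W i) \<phi>" "\<psi> \<in> b" "antimono W"
  obtains m where "i \<le> m" "j \<le> m" "(\<phi>, \<psi>) \<in> cohomologous p X (W m)"
    "singular_cocycle p X (W j) \<psi>" "b = cohomology_class p X (W j) \<psi>"
proof -
  obtain m where m: "i \<le> m" "j \<le> m"
    "cohomology_restrict p X (W m) (cohomology_class p X (W i) \<phi>) = cohomology_restrict p X (W m) b"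
    and b: "b \<in> cohomology p X (W j)"
    using assms by (auto simp: colim_rel_def colim_pairs_def)
  have W: "W m \<subseteq> W i" "W m \<subseteq> W j"
    using m assms antimonoD by blast+
  have \<psi>: "singular_cocycle p X (W j) \<psi>" "b = cohomology_class p X (W j) \<psi>"
    using cohomology_rep [OF b \<open>\<psi> \<in> b\<close>] by auto
  have "cohomology_class p X (W m) \<phi> = cohomology_class p X (W m) \<psi>"
    using m(3) W assms(2) \<psi> by (simp add: cohomology_restrict_class)
  then have "(\<phi>, \<psi>) \<in> cohomologous p X (W m)"
    using cohomology_class_eqD singular_cocycle_mono [OF assms(2) W(1)] by blast
  then show ?thesis
    using m \<psi> that by blast
qed

lemma colim_relI:
  assumes "(\<phi>, \<psi>) \<in> cohomologous p X (W m)" "singular_cocycle p X (W i) \<phi>" "singular_cocycle p X (W j) \<psi>"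
    and "i \<le> m" "j \<le> m" "antimono W"
  shows "((i, cohomology_class p X (W i) \<phi>), (j, cohomology_class p X (W j) \<psi>)) \<in> colim_rel p X W"
proof -
  have W: "W m \<subseteq> W i" "W m \<subseteq> W j"
    using assms antimonoD by blast+
  have "cohomology_class p X (W m) \<phi> = cohomology_class p X (W m) \<psi>"
    using assms cohomology_class_eq by blast
  then show ?thesis
    using assms W colim_pairs_class
    by (auto simp: colim_rel_def cohomology_restrict_class intro!: exI [of _ m])
qed

lemma colim_class_eq:
  assumes "(\<phi>, \<psi>) \<in> cohomologous p X (W m)" "singular_cocycle p X (W i) \<phi>" "singular_cocycle p X (W j) \<psi>"
    and "i \<le> m" "j \<le> m" "antimono W"
  shows "colim_rel p X W `` {(i, cohomology_class p X (W i) \<phi>)} =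
           colim_rel p X W `` {(j, cohomology_class p X (W j) \<psi>)}"
proof -
  have *: "colim_rel p X W `` {(i, cohomology_class p X (W i) \<phi>)} \<subseteq>
           colim_rel p X W `` {(j, cohomology_class p X (W j) \<psi>)}"
    if \<phi>\<psi>: "(\<phi>, \<psi>) \<in> cohomologous p X (W m)" "singular_cocycle p X (W i) \<phi>" "singular_cocycle p X (W j) \<psi>"
      and m: "i \<le> m" "j \<le> m" for \<phi> \<psi> i j
  proof clarify
    fix l b assume b: "((i, cohomology_class p X (W i) \<phi>), (l, b)) \<in> colim_rel p X W"
    then obtain \<xi> where "\<xi> \<in> b"
      by (rule colim_rel_nonempty)
    then obtain m' where m': "i \<le> m'" "l \<le> m'" "(\<phi>, \<xi>) \<in> cohomologous p X (W m')"
      "singular_cocycle p X (W l) \<xi>" "b = cohomology_class p X (W l) \<xi>"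
      using colim_relD [OF b] \<phi>\<psi> assms(6) by blast
    \<comment> \<open>The two comparisons hold at different stages; both survive at the larger
      one.\<close>
    have "(\<phi>, \<psi>) \<in> cohomologous p X (W (max m m'))"
      using \<phi>\<psi>(1) antimonoD [OF assms(6) max.cobounded1] by (rule cohomologous_mono)
    moreover have "(\<phi>, \<xi>) \<in> cohomologous p X (W (max m m'))"
      using m'(3) antimonoD [OF assms(6) max.cobounded2] by (rule cohomologous_mono)
    ultimately have "(\<psi>, \<xi>) \<in> cohomologous p X (W (max m m'))"
      using equiv_cohomologous [of p X "W (max m m')"] by (meson equiv_def symD transD)
    then show "((j, cohomology_class p X (W j) \<psi>), (l, b)) \<in> colim_rel p X W"
      unfolding m'(5) using \<phi>\<psi> m m' assms(6) by (intro colim_relI [where m = "max m m'"]) auto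
  qed
  moreover have "(\<psi>, \<phi>) \<in> cohomologous p X (W m)"
    using assms(1) equiv_cohomologous [of p X "W m"] by (meson equiv_def symD)
  ultimately show ?thesis
    using assms by blast
qed

lemma colim_class_in:
  "singular_cocycle p X (W i) \<phi>
    \<Longrightarrow> colim_rel p X W `` {(i, cohomology_class p X (W i) \<phi>)} \<in> colim_cohomology p X W"
  by (simp add: colim_cohomology_def colim_pairs_class quotientI)

lemma colim_cup_class:
  assumes "singular_cocycle p X (W i) \<phi>" "singular_cocycle q X {} \<psi>" "antimono W"
  shows "colim_cup p q X W (colim_rel p X W `` {(i, cohomology_class p X (W i) \<phi>)}) (cohomology_class q X {} \<psi>) =
           colim_rel (p + q) X W `` {(i, cohomology_class (p + q) X (W i) (cochain_cup p q X \<phi> \<psi>))}"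
    (is "_ = ?R")
proof -
  have "colim_rel (p + q) X W `` {(j, cup p q X (W j) b (cohomology_class q X {} \<psi>))} = ?R"
    if b: "((i, cohomology_class p X (W i) \<phi>), (j, b)) \<in> colim_rel p X W" for j b
  proof -
    obtain \<xi> where "\<xi> \<in> b"
      using b by (rule colim_rel_nonempty)
    then obtain m where m: "i \<le> m" "j \<le> m" "(\<phi>, \<xi>) \<in> cohomologous p X (W m)"
      "singular_cocycle p X (W j) \<xi>" "b = cohomology_class p X (W j) \<xi>"
      using colim_relD [OF b] assms by blast
    have "(\<psi>, \<psi>) \<in> cohomologous q X {}"
      using cohomology_class_self [OF assms(2)] by simp
    then have "(cochain_cup p q X \<phi> \<psi>, cochain_cup p q X \<xi> \<psi>) \<in> cohomologous (p + q) X (W m)"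
      using m by (intro cohomologous_cup)
    then have "?R = colim_rel (p + q) X W `` {(j, cohomology_class (p + q) X (W j) (cochain_cup p q X \<xi> \<psi>))}"
      using m assms by (intro colim_class_eq [where m = m]) (auto intro: singular_cocycle_cup)
    then show ?thesis
      using m assms by (simp add: cup_class)
  qed
  moreover have "((i, cohomology_class p X (W i) \<phi>), (i, cohomology_class p X (W i) \<phi>)) \<in> colim_rel p X W"
    using assms cohomology_class_self by (intro colim_relI [where m = i]) auto
  ultimately show ?thesis
    unfolding colim_cup_def by blast
qed

section \<open>The cap product relative to the ends for empty V\<close>

lemma antimono_end_nbhds:
  assumes "exhaustion X K"
  shows "antimono (end_nbhds K V)"
proof (rule antimonoI, rule lift_Suc_antimono_le)
  show "end_nbhds K V (Suc i) \<subseteq> end_nbhds K V i" for i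
    using assms interior_of_subset [of X "K (Suc i)"] by (auto simp: exhaustion_def end_nbhds_def)
qed

lemma end_nbhds_empty: "end_nbhds K {} = (\<lambda>i. {})"
  by (auto simp: end_nbhds_def)

lemma end_cap_class:
  assumes "exhaustion X K" and W: "W = end_nbhds K (topspace X)"
    and c: "lim_cycle (k + q) X W c" and \<phi>: "singular_cocycle k X (W i) \<phi>"
  shows "end_cap k q X K {} (lim_homologous (k + q) X W `` {c})
           (colim_rel k X W `` {(i, cohomology_class k X (W i) \<phi>)}) =
         lim_homologous q X (\<lambda>i. {}) `` {\<lambda>j. chain_cap k q (c i) \<phi>}" (is "_ = ?R")
proof -
  have mono: "antimono W"
    using assms antimono_end_nbhds by blast
  \<comment> \<open>The components of a limit cycle at stages \<open>j\<close> and \<open>m\<close>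
    differ by a chain in \<open>W j\<close>, which \<open>\<psi>\<close> kills, so the capped chain
    does not depend on the stage.\<close>
  have const: "chain_cap k q (d m) \<psi> = chain_cap k q (d j) \<psi>"
    if "lim_cycle (k + q) X W d" "j \<le> m" "singular_cocycle k X (W j) \<psi>" for d m j \<psi>
    using that mono lim_chain_add [of "k + q" X W d j m] chain_cap_vanishes [of k q X "W j" "d m - d j" \<psi>]
    by (simp add: chain_cap_diff lim_cycle_def singular_cocycle_def)
  \<comment> \<open>\<open>end_cap\<close> is a union over cycles, stages, representatives and
    cut-offs \<open>N\<close>. Every choice has to give the same class; the facts collected at the
    end of the proof show that there is a choice.\<close>
  have "lim_homologous q X (\<lambda>i. {}) `` {\<lambda>l. chain_cap k q (d (max l N)) \<psi>} = ?R"
    if d: "(c, d) \<in> lim_homologous (k + q) X W"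
      and b: "((i, cohomology_class k X (W i) \<phi>), (j, b)) \<in> colim_rel k X W"
      and \<psi>: "\<psi> \<in> b" and N: "j \<le> N" for d j b \<psi> N
  proof -
    have d_cycle: "lim_cycle (k + q) X W d"
      using d by (simp add: lim_homologous_def)
    obtain m where m: "i \<le> m" "j \<le> m" "(\<phi>, \<psi>) \<in> cohomologous k X (W m)"
      "singular_cocycle k X (W j) \<psi>"
      by (rule colim_relD [OF b \<phi> \<psi> mono])
    have "chain_cap k q (d (max l N)) \<psi> = chain_cap k q (d m) \<psi>" for l
    proof -
      have "chain_cap k q (d (max l N)) \<psi> = chain_cap k q (d j) \<psi>"
        using N by (intro const [OF d_cycle _ m(4)]) simp
      also have "\<dots> = chain_cap k q (d m) \<psi>"
        using m(2) by (rule const [OF d_cycle _ m(4), symmetric])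
      finally show ?thesis .
    qed
    then have eq: "(\<lambda>l. chain_cap k q (d (max l N)) \<psi>) = (\<lambda>l. chain_cap k q (d m) \<psi>)"
      by (intro ext)
    have "homologous_rel q X {} (chain_cap k q (c m) \<phi>) (chain_cap k q (d m) \<psi>)"
    proof (rule homologous_rel_cap)
      show "homologous_rel (k + q) X (W m) (c m) (d m)"
        using d by (rule lim_homologous_imp_homologous_rel)
      show "singular_relcycle (k + q) X (W m) (c m)"
        using c by (simp add: lim_cycle_def)
    qed (rule m(3))
    moreover have "chain_cap k q (c m) \<phi> = chain_cap k q (c i) \<phi>"
      using m(1) by (rule const [OF c _ \<phi>])
    moreover have "singular_relcycle q X {} (chain_cap k q (c i) \<phi>)"
      using c \<phi> singular_cycle_cap [of k q X "W i" "c i" \<phi>] by (simp add: lim_cycle_def)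
    ultimately have "(\<lambda>l. chain_cap k q (c i) \<phi>, \<lambda>l. chain_cap k q (d m) \<psi>) \<in> lim_homologous q X (\<lambda>i. {})"
      by (intro lim_homologous_const) simp_all
    then show ?thesis
      unfolding eq by (rule lim_class_eq [symmetric])
  qed
  moreover have "((i, cohomology_class k X (W i) \<phi>), (i, cohomology_class k X (W i) \<phi>)) \<in> colim_rel k X W"
    using \<phi> mono cohomology_class_self by (intro colim_relI [where m = i]) auto
  moreover have "(c, c) \<in> lim_homologous (k + q) X W"
    using c by (rule lim_homologous_refl)
  moreover have "\<phi> \<in> cohomology_class k X (W i) \<phi>"
    using \<phi> by (rule cohomology_class_self)
  moreover have "X frontier_of {} \<subseteq> K i"
    by simp
  ultimately show ?thesis
    unfolding end_cap_def end_nbhds_empty by fast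
qed


subsection \<open>The prism operator\<close>

text \<open>The i-th degeneracy in barycentric coordinates: it sends the vertices i and i + 1 to
  vertex i.\<close>

definition collapse :: "nat \<Rightarrow> (nat \<Rightarrow> real) \<Rightarrow> nat \<Rightarrow> real" where
  "collapse i t = (\<lambda>j. if j < i then t j else if j = i then t i + t (Suc i) else t (Suc j))"

text \<open>
  The face \<open>[v\<^sub>0, \<dots>, v\<^sub>i, w\<^sub>i, \<dots>, w\<^sub>n]\<close> of the prism over \<open>\<sigma>\<close> with vertices \<open>v\<^sub>j\<close> at height \<open>s\<close> and
  \<open>w\<^sub>j\<close> at height \<open>s + 1\<close>.
\<close>

definition prism_simplex ::
    "nat \<Rightarrow> real \<Rightarrow> nat \<Rightarrow> ((nat \<Rightarrow> real) \<Rightarrow> 'a) \<Rightarrow> (nat \<Rightarrow> real) \<Rightarrow> 'a \<times> real" where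
  "prism_simplex n s i \<sigma> =
     (\<lambda>t\<in>standard_simplex (Suc n). (\<sigma> (collapse i t), s + (\<Sum>j\<in>{Suc i..Suc n}. t j)))"

definition prism :: "nat \<Rightarrow> real \<Rightarrow> 'a chain \<Rightarrow> ('a \<times> real) chain" where
  "prism n s = frag_extend (\<lambda>\<sigma>. \<Sum>i\<le>n. frag_cmul ((-1) ^ i) (frag_of (prism_simplex n s i \<sigma>)))"

lemma prism_of:
  "prism n s (frag_of \<sigma>) = (\<Sum>i\<le>n. frag_cmul ((-1) ^ i) (frag_of (prism_simplex n s i \<sigma>)))"
  by (simp add: prism_def)

lemma prism_0 [simp]: "prism n s 0 = 0"
  by (simp add: prism_def)

lemma prism_diff: "prism n s (a - b) = prism n s a - prism n s b"
  by (simp add: prism_def frag_extend_diff)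

lemma prism_cmul: "prism n s (frag_cmul k a) = frag_cmul k (prism n s a)"
  by (simp add: prism_def frag_extend_cmul)

lemma prism_sum: "finite I \<Longrightarrow> prism n s (\<Sum>i\<in>I. f i) = (\<Sum>i\<in>I. prism n s (f i))"
  by (simp add: prism_def frag_extend_sum o_def)

lemma collapse_in_standard_simplex:
  assumes "t \<in> standard_simplex (Suc n)" "i \<le> n"
  shows "collapse i t \<in> standard_simplex n"
proof -
  have t: "\<And>j. 0 \<le> t j" "\<And>j. j > Suc n \<Longrightarrow> t j = 0" "(\<Sum>j\<le>Suc n. t j) = 1"
    using assms by (auto simp: standard_simplex_def)
  have "(\<Sum>j\<le>n. collapse i t j) = (\<Sum>j\<le>Suc n. t j)"
    using \<open>i \<le> n\<close>
  proof (induction n rule: dec_induct)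
    case base
    have "(\<Sum>j<i. collapse i t j) = (\<Sum>j<i. t j)"
      by (simp add: collapse_def)
    then show ?case
      by (simp add: collapse_def flip: lessThan_Suc_atMost)
  next
    case (step m)
    then show ?case
      by (simp add: collapse_def)
  qed
  then have sum: "(\<Sum>j\<le>n. collapse i t j) = 1"
    using t by simp
  have nonneg: "0 \<le> collapse i t j" for j
    using t by (simp add: collapse_def)
  have zero: "collapse i t j = 0" if "j > n" for j
    using t that assms by (simp add: collapse_def)
  have "collapse i t j \<le> 1" for j
  proof (cases "j \<le> n")
    case True
    then have "collapse i t j \<le> (\<Sum>j\<le>n. collapse i t j)"
      using nonneg by (intro member_le_sum) auto
    then show ?thesis
      using sum by simp
  qed (simp add: zero)
  then show ?thesis
    using sum nonneg zero by (auto simp: standard_simplex_def)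
qed

lemma continuous_map_collapse:
  assumes "i \<le> n"
  shows "continuous_map (subtopology (powertop_real UNIV) (standard_simplex (Suc n)))
           (subtopology (powertop_real UNIV) (standard_simplex n)) (collapse i)"
proof -
  have "continuous_map (subtopology (powertop_real UNIV) (standard_simplex (Suc n))) euclideanreal
          (\<lambda>t. collapse i t j)" for j
    unfolding collapse_def
    by (auto intro!: continuous_map_from_subtopology continuous_intros continuous_map_product_projection)
  then show ?thesis
    using assms
    by (auto simp: continuous_map_in_subtopology continuous_map_componentwise
             intro: collapse_in_standard_simplex)
qed

lemma prism_height:
  assumes "t \<in> standard_simplex n"
  shows "(\<Sum>j\<in>{i..n}. t j) \<in> {0..1}"
proof -
  have t: "\<And>j. 0 \<le> t j" "(\<Sum>j\<le>n. t j) = 1"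
    using assms by (auto simp: standard_simplex_def)
  have "(\<Sum>j\<in>{i..n}. t j) \<le> (\<Sum>j\<le>n. t j)"
    using t by (intro sum_mono2) auto
  then show ?thesis
    using t by (simp add: sum_nonneg)
qed

text \<open>The strip in the conclusion is recorded because it later shows that prisms far from
  height 0 avoid a given slab.\<close>

lemma singular_simplex_prism:
  assumes "singular_simplex n X \<sigma>" "i \<le> n"
  shows "singular_simplex (Suc n) (subtopology (prod_topology X euclideanreal) (UNIV \<times> {s..s + 1}))
           (prism_simplex n s i \<sigma>)"
proof -
  let ?D = "subtopology (powertop_real UNIV) (standard_simplex (Suc n))"
  have "continuous_map ?D X (\<sigma> \<circ> collapse i)"
    using assms continuous_map_collapse continuous_map_compose unfolding singular_simplex_def by blast
  moreover have "continuous_map ?D euclideanreal (\<lambda>t. s + (\<Sum>j\<in>{Suc i..Suc n}. t j))"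
    by (intro continuous_map_from_subtopology continuous_intros continuous_map_product_projection) auto
  ultimately have "continuous_map ?D (prod_topology X euclideanreal)
                     (\<lambda>t. (\<sigma> (collapse i t), s + (\<Sum>j\<in>{Suc i..Suc n}. t j)))"
    by (simp add: continuous_map_pairwise o_def)
  moreover have "(\<Sum>j\<in>{Suc i..Suc n}. t j) \<in> {0..1}" if "t \<in> standard_simplex (Suc n)" for t
    using that by (rule prism_height)
  ultimately show ?thesis
    unfolding singular_simplex_subtopology
    by (auto simp: singular_simplex_def prism_simplex_def simp del: sum.cl_ivl_Suc)
qed

lemma singular_chain_prism:
  assumes "singular_chain n X c"
  shows "singular_chain (Suc n) (subtopology (prod_topology X euclideanreal) (UNIV \<times> {s..s + 1}))
           (prism n s c)"
  using assms unfolding prism_def singular_chain_def [of n]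
  by (intro singular_chain_extend singular_chain_sum singular_chain_cmul)
     (auto simp: singular_chain_of intro: singular_simplex_prism)

text \<open>Deleting v_j with j <= i from [v_0, ..., v_(i+1), w_(i+1), ..., w_n] removes one v
  before the doubled vertex, so the index of the prism simplex drops to i.\<close>

lemma face_prism_simplex_below:
  assumes "j \<le> i" "i < n"
  shows "singular_face (Suc n) j (prism_simplex n s (Suc i) \<sigma>) =
           prism_simplex (n - 1) s i (singular_face n j \<sigma>)"
proof
  fix t
  obtain m where n: "n = Suc m"
    using assms by (cases n) auto
  show "singular_face (Suc n) j (prism_simplex n s (Suc i) \<sigma>) t =
           prism_simplex (n - 1) s i (singular_face n j \<sigma>) t"
  proof (cases "t \<in> standard_simplex n")
    case True
    then have "simplical_face j t \<in> standard_simplex (Suc n)" "collapse i t \<in> standard_simplex m"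
      using assms n simplical_face_in_standard_simplex [of "Suc n" j t]
        collapse_in_standard_simplex [of t m i] by auto
    moreover have "collapse (Suc i) (simplical_face j t) = simplical_face j (collapse i t)"
      using assms by (auto simp: collapse_def simplical_face_def fun_eq_iff)
    moreover have "(\<Sum>l\<in>{Suc (Suc i)..Suc n}. simplical_face j t l) = (\<Sum>l\<in>{Suc i..n}. t l)"
      unfolding sum.shift_bounds_cl_Suc_ivl using assms
      by (intro sum.cong) (auto simp: simplical_face_def)
    ultimately show ?thesis
      using True n by (simp add: singular_face_def prism_simplex_def del: sum.cl_ivl_Suc)
  qed (simp add: singular_face_def prism_simplex_def n)
qed

text \<open>For j > i the vertex w_j stands in place j + 1 of [v_0, ..., v_i, w_i, ..., w_n]; this
  explains the shift of the face number.\<close>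

lemma face_prism_simplex_above:
  assumes "i < j" "j \<le> n"
  shows "singular_face (Suc n) (Suc j) (prism_simplex n s i \<sigma>) =
           prism_simplex (n - 1) s i (singular_face n j \<sigma>)"
proof
  fix t
  obtain m where n: "n = Suc m"
    using assms by (cases n) auto
  show "singular_face (Suc n) (Suc j) (prism_simplex n s i \<sigma>) t =
           prism_simplex (n - 1) s i (singular_face n j \<sigma>) t"
  proof (cases "t \<in> standard_simplex n")
    case True
    then have "simplical_face (Suc j) t \<in> standard_simplex (Suc n)" "collapse i t \<in> standard_simplex m"
      using assms n simplical_face_in_standard_simplex [of "Suc n" "Suc j" t]
        collapse_in_standard_simplex [of t m i] by auto
    moreover have "collapse i (simplical_face (Suc j) t) = simplical_face j (collapse i t)"
      using assms by (auto simp: collapse_def simplical_face_def fun_eq_iff)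
    moreover have "(\<Sum>l\<in>{Suc i..Suc n}. simplical_face (Suc j) t l) = (\<Sum>l\<in>{Suc i..n}. t l)"
    proof -
      \<comment> \<open>Place j + 1 holds the inserted zero, so the sum is cut just before it and
        the tail is shifted back by one.\<close>
      have "(\<Sum>l\<in>{Suc i..Suc n}. simplical_face (Suc j) t l) =
          (\<Sum>l\<in>{Suc i..j}. simplical_face (Suc j) t l) + (\<Sum>l\<in>{Suc j..Suc n}. simplical_face (Suc j) t l)"
      proof -
        have "{Suc i..Suc n} = {Suc i..j} \<union> {Suc j..Suc n}"
          using assms by auto
        then show ?thesis
          by (simp only:) (rule sum.union_disjoint, auto)
      qed
      also have "(\<Sum>l\<in>{Suc j..Suc n}. simplical_face (Suc j) t l) = (\<Sum>l\<in>{Suc (Suc j)..Suc n}. simplical_face (Suc j) t l)"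
        using assms by (subst sum.atLeast_Suc_atMost) (auto simp: simplical_face_def)
      also have "\<dots> = (\<Sum>l\<in>{Suc j..n}. t l)"
        unfolding sum.shift_bounds_cl_Suc_ivl by (intro sum.cong) (auto simp: simplical_face_def)
      also have "(\<Sum>l\<in>{Suc i..j}. simplical_face (Suc j) t l) = (\<Sum>l\<in>{Suc i..j}. t l)"
        by (intro sum.cong) (auto simp: simplical_face_def)
      also have "(\<Sum>l\<in>{Suc i..j}. t l) + (\<Sum>l\<in>{Suc j..n}. t l) = (\<Sum>l\<in>{Suc i..n}. t l)"
        using assms sum.ub_add_nat [of "Suc i" j t "n - j"] by simp
      finally show ?thesis .
    qed
    ultimately show ?thesis
      using True n by (simp add: singular_face_def prism_simplex_def del: sum.cl_ivl_Suc)
  qed (simp add: singular_face_def prism_simplex_def n)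
qed

text \<open>For 1 <= i <= n this is the wall [v_0, ..., v_(i-1), w_i, ..., w_n] shared by the prism
  simplices i - 1 and i. The extreme values i = 0 and i = n + 1 are the top and the bottom of the
  prism.\<close>

definition prism_level :: "nat \<Rightarrow> real \<Rightarrow> nat \<Rightarrow> ((nat \<Rightarrow> real) \<Rightarrow> 'a) \<Rightarrow> (nat \<Rightarrow> real) \<Rightarrow> 'a \<times> real" where
  "prism_level n s i \<sigma> = (\<lambda>t\<in>standard_simplex n. (\<sigma> t, s + (\<Sum>j\<in>{i..n}. t j)))"

lemma prism_level_0: "prism_level n s 0 \<sigma> = simplex_map n (\<lambda>x. (x, s + 1)) \<sigma>"
  by (auto simp: prism_level_def simplex_map_def fun_eq_iff standard_simplex_def atLeast0AtMost)

lemma prism_level_Suc: "prism_level n s (Suc n) \<sigma> = simplex_map n (\<lambda>x. (x, s)) \<sigma>"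
  by (auto simp: prism_level_def simplex_map_def fun_eq_iff)

lemma face_prism_simplex_eq:
  assumes "i \<le> n"
  shows "singular_face (Suc n) i (prism_simplex n s i \<sigma>) = prism_level n s i \<sigma>"
proof
  fix t
  show "singular_face (Suc n) i (prism_simplex n s i \<sigma>) t = prism_level n s i \<sigma> t"
  proof (cases "t \<in> standard_simplex n")
    case True
    then have "simplical_face i t \<in> standard_simplex (Suc n)"
      using assms simplical_face_in_standard_simplex [of "Suc n" i t] by auto
    moreover have "collapse i (simplical_face i t) = t"
      by (auto simp: collapse_def simplical_face_def fun_eq_iff)
    moreover have "(\<Sum>l\<in>{Suc i..Suc n}. simplical_face i t l) = (\<Sum>l\<in>{i..n}. t l)"
      unfolding sum.shift_bounds_cl_Suc_ivl by (intro sum.cong) (auto simp: simplical_face_def)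
    ultimately show ?thesis
      using True by (simp add: singular_face_def prism_simplex_def prism_level_def del: sum.cl_ivl_Suc)
  qed (simp add: singular_face_def prism_level_def)
qed

lemma face_prism_simplex_Suc:
  assumes "i \<le> n"
  shows "singular_face (Suc n) (Suc i) (prism_simplex n s i \<sigma>) = prism_level n s (Suc i) \<sigma>"
proof
  fix t
  show "singular_face (Suc n) (Suc i) (prism_simplex n s i \<sigma>) t = prism_level n s (Suc i) \<sigma> t"
  proof (cases "t \<in> standard_simplex n")
    case True
    then have "simplical_face (Suc i) t \<in> standard_simplex (Suc n)"
      using assms simplical_face_in_standard_simplex [of "Suc n" "Suc i" t] by auto
    moreover have "collapse i (simplical_face (Suc i) t) = t"
      by (auto simp: collapse_def simplical_face_def fun_eq_iff)
    moreover have "(\<Sum>l\<in>{Suc i..Suc n}. simplical_face (Suc i) t l) = (\<Sum>l\<in>{Suc i..n}. t l)"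
    proof -
      have "(\<Sum>l\<in>{Suc i..Suc n}. simplical_face (Suc i) t l) = (\<Sum>l\<in>{Suc (Suc i)..Suc n}. simplical_face (Suc i) t l)"
        using assms by (subst sum.atLeast_Suc_atMost) (auto simp: simplical_face_def)
      also have "\<dots> = (\<Sum>l\<in>{Suc i..n}. t l)"
        unfolding sum.shift_bounds_cl_Suc_ivl by (intro sum.cong) (auto simp: simplical_face_def)
      finally show ?thesis .
    qed
    ultimately show ?thesis
      using True by (simp add: singular_face_def prism_simplex_def prism_level_def del: sum.cl_ivl_Suc)
  qed (simp add: singular_face_def prism_level_def)
qed

text \<open>The three groups are the two walls of each prism simplex, the faces deleting an earlier
  v, and those deleting a later w. After reindexing, the last two groups both run over i <= m,
  because row 0 has no earlier face and row m + 1 no later one.\<close>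

lemma sum_prism_faces:
  fixes g :: "nat \<Rightarrow> nat \<Rightarrow> 'b::ab_group_add"
  shows "(\<Sum>i\<le>Suc m. \<Sum>j\<le>Suc (Suc m). g i j) =
     (\<Sum>i\<le>Suc m. g i i + g i (Suc i)) + (\<Sum>i\<le>m. \<Sum>j\<le>i. g (Suc i) j) +
     (\<Sum>i\<le>m. \<Sum>j\<in>{Suc i..Suc m}. g i (Suc j))"
proof -
  have row: "(\<Sum>j\<le>Suc (Suc m). g i j) =
      (\<Sum>j<i. g i j) + (g i i + g i (Suc i)) + (\<Sum>j\<in>{Suc i..Suc m}. g i (Suc j))"
    if "i \<le> Suc m" for i
  proof -
    have "{..Suc (Suc m)} = {..<i} \<union> ({i, Suc i} \<union> {Suc (Suc i)..Suc (Suc m)})"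
      using that by auto
    then have "(\<Sum>j\<le>Suc (Suc m). g i j) =
        (\<Sum>j<i. g i j) + (\<Sum>j\<in>{i, Suc i} \<union> {Suc (Suc i)..Suc (Suc m)}. g i j)"
      by (simp only:) (rule sum.union_disjoint, auto)
    also have "(\<Sum>j\<in>{i, Suc i} \<union> {Suc (Suc i)..Suc (Suc m)}. g i j) =
        (g i i + g i (Suc i)) + (\<Sum>j\<in>{Suc (Suc i)..Suc (Suc m)}. g i j)"
      by (subst sum.union_disjoint) (auto simp del: sum.cl_ivl_Suc)
    finally show ?thesis
      unfolding sum.shift_bounds_cl_Suc_ivl by (simp add: add.assoc)
  qed
  have "(\<Sum>i\<le>Suc m. \<Sum>j<i. g i j) = (\<Sum>i\<le>m. \<Sum>j\<le>i. g (Suc i) j)"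
    unfolding sum.atMost_Suc_shift by (simp add: lessThan_Suc_atMost)
  moreover have "(\<Sum>i\<le>Suc m. \<Sum>j\<in>{Suc i..Suc m}. g i (Suc j)) = (\<Sum>i\<le>m. \<Sum>j\<in>{Suc i..Suc m}. g i (Suc j))"
    by simp
  ultimately show ?thesis
    by (simp add: row sum.distrib del: sum.atMost_Suc sum.cl_ivl_Suc)
qed

text \<open>The walls telescope to top minus bottom. The other faces are prism simplices over the
  faces of \<open>\<sigma>\<close>, with opposite sign because exactly one of the two indices is
  shifted by one.\<close>

lemma chain_boundary_prism:
  assumes "n > 0"
  shows "chain_boundary (Suc n) (prism n s c) =
           chain_map n (\<lambda>x. (x, s + 1)) c - chain_map n (\<lambda>x. (x, s)) c
             - prism (n - 1) s (chain_boundary n c)"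
proof -
  obtain m where n: "n = Suc m"
    using assms by (cases n) auto
  have "Poly_Mapping.keys c \<subseteq> UNIV"
    by simp
  then show ?thesis
  proof (induction c rule: frag_induction)
    case (one \<sigma>)
    define f where "f i j = frag_cmul ((-1) ^ (i + j)) (frag_of (singular_face (Suc n) j (prism_simplex n s i \<sigma>)))"
      for i j
    define h where "h i j = frag_cmul ((-1) ^ (i + j)) (frag_of (prism_simplex m s i (singular_face n j \<sigma>)))"
      for i j
    have "chain_boundary (Suc n) (prism n s (frag_of \<sigma>)) = (\<Sum>i\<le>Suc m. \<Sum>j\<le>Suc (Suc m). f i j)"
      by (simp add: prism_of chain_boundary_sum chain_boundary_cmul chain_boundary_of frag_cmul_sum f_def n
          power_add o_def del: sum.atMost_Suc)
    also have "\<dots> = (\<Sum>i\<le>Suc m. f i i + f i (Suc i)) + (\<Sum>i\<le>m. \<Sum>j\<le>i. f (Suc i) j) +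
     (\<Sum>i\<le>m. \<Sum>j\<in>{Suc i..Suc m}. f i (Suc j))"
      by (rule sum_prism_faces)
    also have "(\<Sum>i\<le>Suc m. f i i + f i (Suc i)) =
        (\<Sum>i\<le>Suc m. frag_of (prism_level n s i \<sigma>) - frag_of (prism_level n s (Suc i) \<sigma>))"
      by (intro sum.cong) (auto simp: f_def face_prism_simplex_eq face_prism_simplex_Suc n)
    also have "\<dots> = frag_of (prism_level n s 0 \<sigma>) - frag_of (prism_level n s (Suc n) \<sigma>)"
      using sum_telescope [of "\<lambda>i. frag_of (prism_level n s i \<sigma>)" "Suc m"] by (simp only: n)
    also have "(\<Sum>i\<le>m. \<Sum>j\<le>i. f (Suc i) j) = (\<Sum>i\<le>m. \<Sum>j\<le>i. - h i j)"
      by (intro sum.cong) (auto simp: f_def h_def face_prism_simplex_below n simp flip: frag_cmul_minus_one)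
    also have "(\<Sum>i\<le>m. \<Sum>j\<in>{Suc i..Suc m}. f i (Suc j)) = (\<Sum>i\<le>m. \<Sum>j\<in>{Suc i..Suc m}. - h i j)"
      by (intro sum.cong) (auto simp: f_def h_def face_prism_simplex_above n simp flip: frag_cmul_minus_one)
    also have "frag_of (prism_level n s 0 \<sigma>) - frag_of (prism_level n s (Suc n) \<sigma>) +
        (\<Sum>i\<le>m. \<Sum>j\<le>i. - h i j) + (\<Sum>i\<le>m. \<Sum>j\<in>{Suc i..Suc m}. - h i j) =
        frag_of (prism_level n s 0 \<sigma>) - frag_of (prism_level n s (Suc n) \<sigma>) - (\<Sum>i\<le>m. \<Sum>j\<le>Suc m. h i j)"
    proof -
      have "(\<Sum>j\<le>Suc m. h i j) = (\<Sum>j\<le>i. h i j) + (\<Sum>j\<in>{Suc i..Suc m}. h i j)" if "i \<le> m" for i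
      proof -
        have "{..Suc m} = {..i} \<union> {Suc i..Suc m}"
          using that by auto
        then show ?thesis
          by (simp only:) (rule sum.union_disjoint, auto)
      qed
      then have "(\<Sum>i\<le>m. \<Sum>j\<le>Suc m. h i j) = (\<Sum>i\<le>m. \<Sum>j\<le>i. h i j) + (\<Sum>i\<le>m. \<Sum>j\<in>{Suc i..Suc m}. h i j)"
        by (simp add: sum.distrib del: sum.atMost_Suc sum.cl_ivl_Suc)
      then show ?thesis
        by (simp add: sum_negf del: sum.atMost_Suc sum.cl_ivl_Suc)
    qed
    also have "(\<Sum>i\<le>m. \<Sum>j\<le>Suc m. h i j) = prism m s (chain_boundary n (frag_of \<sigma>))"
      unfolding sum.swap [of _ _ "{..m}"]
      by (simp add: n chain_boundary_of prism_sum prism_cmul prism_of frag_cmul_sum h_def power_add mult.commute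
          del: sum.atMost_Suc)
    finally show ?case
      by (simp add: prism_level_0 prism_level_Suc n)
  next
    case (diff a b)
    then show ?case
      by (simp add: prism_diff chain_boundary_diff chain_map_diff)
  qed auto
qed


subsection \<open>The step cocycle\<close>

text \<open>The test point is the only point of the standard 0-simplex; height 0 is counted as above
  the step.\<close>

definition step_cochain :: "'a topology \<Rightarrow> ('a \<times> real) cochain" where
  "step_cochain X = (\<lambda>\<sigma>.
     if singular_simplex 0 (prod_topology X euclideanreal) \<sigma> \<and> 0 \<le> snd (\<sigma> (\<lambda>j. if j = 0 then 1 else 0))
     then 1 else 0)"

text \<open>A coboundary in the absolute complex, but of a cochain that does not vanish near the
  upper end; this is how it can represent a nontrivial compactly supported class.\<close>

definition step_cocycle :: "'a topology \<Rightarrow> ('a \<times> real) cochain" where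
  "step_cocycle X = cochain_coboundary 0 (prod_topology X euclideanreal) (step_cochain X)"

lemma step_cocycle_eval:
  assumes "singular_simplex 1 (prod_topology X euclideanreal) \<sigma>"
  shows "step_cocycle X \<sigma> =
           (if 0 \<le> snd (\<sigma> (\<lambda>j. if j = 1 then 1 else 0)) then 1 else 0) -
           (if 0 \<le> snd (\<sigma> (\<lambda>j. if j = 0 then 1 else 0)) then 1 else 0)"
proof -
  have sing: "singular_simplex 0 (prod_topology X euclideanreal) (singular_face (Suc 0) i \<sigma>)" if "i \<le> 1" for i
    using assms that singular_simplex_singular_face [of 1 _ \<sigma> i] by simp
  have "simplical_face 0 (\<lambda>j. if j = 0 then 1 else 0) = (\<lambda>j. if j = 1 then 1 else (0::real))"
    "simplical_face (Suc 0) (\<lambda>j. if j = 0 then 1 else 0) = (\<lambda>j. if j = 0 then 1 else (0::real))"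
    by (auto simp: simplical_face_def fun_eq_iff)
  then show ?thesis
    using assms sing [of 0] sing [of 1]
    by (simp add: step_cocycle_def cochain_coboundary_def cochain_eval_boundary_of step_cochain_def
        singular_face_def)
qed

text \<open>The heights along a singular 1-simplex form a connected set. If it avoids 0, both ends
  are on the same side of the step and the coboundary vanishes.\<close>

lemma singular_cocycle_step:
  assumes "\<And>x r. (x, r) \<in> A \<Longrightarrow> r \<noteq> 0"
  shows "singular_cocycle 1 (prod_topology X euclideanreal) A (step_cocycle X)"
proof -
  let ?Y = "prod_topology X euclideanreal"
  have "singular_cochain 0 ?Y {} (step_cochain X)"
    by (auto simp: singular_cochain_def step_cochain_def singular_simplex_empty)
  then have "singular_cocycle (Suc 0) ?Y {} (step_cocycle X)"
    unfolding step_cocycle_def by (rule singular_cocycle_coboundary)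
  moreover have "step_cocycle X \<sigma> = 0" if \<sigma>: "singular_simplex 1 (subtopology ?Y A) \<sigma>" for \<sigma>
  proof -
    let ?D = "subtopology (powertop_real UNIV) (standard_simplex 1)"
    let ?h = "snd \<circ> \<sigma>"
    have \<sigma>': "singular_simplex 1 ?Y \<sigma>" "\<sigma> ` standard_simplex 1 \<subseteq> A"
      using \<sigma> by (auto simp: singular_simplex_subtopology)
    have "continuous_map ?D euclideanreal ?h"
      using \<sigma>' continuous_map_compose [OF _ continuous_map_snd] unfolding singular_simplex_def by blast
    moreover have "connectedin ?D (standard_simplex 1)"
      using connectedin_standard_simplex by (simp add: connectedin_subtopology)
    ultimately have conn: "connected (?h ` standard_simplex 1)"
      using connectedin_continuous_map_image connectedin_iff_connected by blast
    have nonzero: "0 \<notin> ?h ` standard_simplex 1"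
    proof
      assume "0 \<in> ?h ` standard_simplex 1"
      then obtain v where "v \<in> standard_simplex 1" "snd (\<sigma> v) = 0"
        by auto
      then have "\<sigma> v \<in> A" "\<sigma> v = (fst (\<sigma> v), 0)"
        using \<sigma>'(2) by (auto simp: prod_eq_iff)
      then show False
        using assms by metis
    qed
    have same: "0 \<le> ?h a" if "0 \<le> ?h b" "a \<in> standard_simplex 1" "b \<in> standard_simplex 1" for a b
    proof (rule ccontr)
      assume "\<not> 0 \<le> ?h a"
      then have "0 \<in> {?h a..?h b}"
        using that by simp
      then show False
        using connected_contains_Icc [OF conn] that nonzero by blast
    qed
    have "0 \<le> ?h (\<lambda>j. if j = 0 then 1 else 0) \<longleftrightarrow> 0 \<le> ?h (\<lambda>j. if j = 1 then 1 else 0)"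
      using same by (metis basis_in_standard_simplex le_refl zero_le)
    then show ?thesis
      using step_cocycle_eval [OF \<sigma>'(1)] by simp
  qed
  ultimately show ?thesis
    by (simp add: singular_cocycle_def singular_cochain_def)
qed

text \<open>The front edge of the i-th prism simplex is [v_0, v_1] for i > 0, with both ends at
  height s, and [v_0, w_0] for i = 0. Only the latter can cross the step, and the complementary back
  face is [w_0, ..., w_n], the copy at height s + 1.\<close>

lemma prism_cap_step:
  assumes "singular_chain n X c"
  shows "chain_cap 1 n (prism n s c) (step_cocycle X) =
           frag_cmul ((if 0 \<le> s + 1 then 1 else 0) - (if 0 \<le> s then 1 else 0))
             (chain_map n (\<lambda>x. (x, s + 1)) c)"
  using assms unfolding singular_chain_def
proof (induction c rule: frag_induction)
  case (one \<sigma>)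
  let ?Y = "prod_topology X euclideanreal"
  let ?a = "(if 0 \<le> s + 1 then 1 else 0) - (if 0 \<le> s then 1 else 0) :: int"
  have vertex: "snd (prism_simplex n s i \<sigma> (\<lambda>j. if j = l then 1 else 0)) = s + (if i < l then 1 else 0)"
    if "l \<le> 1" "i \<le> n" for i l
    using that by (simp add: prism_simplex_def sum.delta del: sum.cl_ivl_Suc)
  have step: "step_cocycle X (front_face 1 (prism_simplex n s i \<sigma>)) = (if i = 0 then ?a else 0)"
    if "i \<le> n" for i
  proof -
    have "singular_simplex (Suc n) ?Y (prism_simplex n s i \<sigma>)"
      using one that singular_simplex_prism [of n X \<sigma> i s] by (simp add: singular_simplex_subtopology)
    then have "singular_simplex 1 ?Y (front_face 1 (prism_simplex n s i \<sigma>))"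
      by (rule singular_simplex_front_face) simp
    then show ?thesis
      using that vertex [of 0 i] vertex [of 1 i]
      by (cases "i = 0") (simp_all add: step_cocycle_eval, simp_all add: front_face_def)
  qed
  have back_eq: "back_face 1 n (prism_simplex n s 0 \<sigma>) = simplex_map n (\<lambda>x. (x, s + 1)) \<sigma>"
  proof
    fix t
    show "back_face 1 n (prism_simplex n s 0 \<sigma>) t = simplex_map n (\<lambda>x. (x, s + 1)) \<sigma> t"
    proof (cases "t \<in> standard_simplex n")
      case True
      \<comment> \<open>\<open>u\<close> is \<open>t\<close> moved to the back face, with weight
        zero on v_0; collapsing absorbs this zero, and the whole weight sits on the upper
        vertices.\<close>
      define u where "u = (\<lambda>i. if i = 0 then 0 else t (i - Suc 0))"
      have "u \<in> standard_simplex (Suc n)"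
        using shift_in_standard_simplex [OF True, of "Suc 0"] by (simp add: u_def)
      moreover have "collapse 0 u = t"
        by (auto simp: collapse_def fun_eq_iff u_def)
      moreover have "(\<Sum>j\<in>{Suc 0..Suc n}. u j) = 1"
        using True unfolding sum.shift_bounds_cl_Suc_ivl
        by (simp add: standard_simplex_def atLeast0AtMost u_def)
      ultimately have "prism_simplex n s 0 \<sigma> u = (\<sigma> t, s + 1)"
        by (simp add: prism_simplex_def del: sum.cl_ivl_Suc)
      moreover have "back_face 1 n (prism_simplex n s 0 \<sigma>) t = prism_simplex n s 0 \<sigma> u"
        using True by (simp add: back_face_def u_def)
      ultimately show ?thesis
        using True by (simp add: simplex_map_def)
    qed (simp add: back_face_def simplex_map_def)
  qed
  have "chain_cap 1 n (frag_cmul ((-1) ^ i) (frag_of (prism_simplex n s i \<sigma>))) (step_cocycle X) =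
      (if i = 0 then frag_cmul ?a (frag_of (simplex_map n (\<lambda>x. (x, s + 1)) \<sigma>)) else 0)" if "i \<le> n" for i
    using step [OF that] back_eq by (cases "i = 0") (simp_all add: chain_cap_cmul del: One_nat_def)
  then have "chain_cap 1 n (prism n s (frag_of \<sigma>)) (step_cocycle X) =
      (\<Sum>i\<le>n. if i = 0 then frag_cmul ?a (frag_of (simplex_map n (\<lambda>x. (x, s + 1)) \<sigma>)) else 0)"
    unfolding prism_of chain_cap_sum by (intro sum.cong) auto
  then show ?case
    by (simp add: sum.delta)
next
  case (diff a b)
  then show ?case
    by (simp add: prism_diff chain_cap_diff chain_map_diff frag_cmul_diff_right)
qed auto


subsection \<open>Local homology of a product with a line\<close>

lemma generates_group_iso:
  assumes "f \<in> iso G H" "group G" "group H" "u \<in> carrier G"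
  shows "generates_group H (f u) \<longleftrightarrow> generates_group G u"
proof -
  interpret group_hom G H f
    using assms by (simp add: group_hom_def group_hom_axioms_def iso_imp_homomorphism)
  have inj: "inj_on f (carrier G)" and surj: "f ` carrier G = carrier H"
    using assms by (auto simp: iso_def bij_betw_def)
  have "carrier (subgroup_generated H {f u}) = f ` carrier (subgroup_generated G {u})"
    using subgroup_generated_by_image [of "{u}"] assms by simp
  moreover have "carrier (subgroup_generated G {u}) \<subseteq> carrier G"
    by (rule G.carrier_subgroup_generated_subset)
  ultimately show ?thesis
    using assms inj surj unfolding generates_group_def
    by (metis hom_closed inj_on_image_eq_iff order_refl)
qed

lemma generates_group_inv:
  assumes "group G" "generates_group G u"
  shows "generates_group G (inv\<^bsub>G\<^esub> u)"
proof -
  interpret group G by fact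
  have u: "u \<in> carrier G" "range (\<lambda>n::int. u [^]\<^bsub>G\<^esub> n) = carrier G"
    using assms carrier_subgroup_generated_by_singleton by (auto simp: generates_group_def)
  have "u [^]\<^bsub>G\<^esub> n \<in> range (\<lambda>n::int. (inv\<^bsub>G\<^esub> u) [^]\<^bsub>G\<^esub> n)" for n :: int
    using u(1) by (intro image_eqI [of _ _ "- n"]) (auto simp: int_pow_inv int_pow_neg)
  then have "carrier G \<subseteq> range (\<lambda>n::int. (inv\<^bsub>G\<^esub> u) [^]\<^bsub>G\<^esub> n)"
    by (auto simp flip: u(2))
  moreover have "(inv\<^bsub>G\<^esub> u) [^]\<^bsub>G\<^esub> n \<in> carrier G" for n :: int
    using u(1) by simp
  ultimately show ?thesis
    using u carrier_subgroup_generated_by_singleton [of "inv\<^bsub>G\<^esub> u"]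
    unfolding generates_group_def by auto
qed

text \<open>The bottom of a prism enters its boundary with a minus sign, and inversion preserves
  generators.\<close>

lemma generates_homology_minus:
  assumes "singular_relcycle p X S c"
    and "generates_group (relative_homology_group (int p) X S) (homologous_rel_set p X S c)"
  shows "generates_group (relative_homology_group (int p) X S) (homologous_rel_set p X S (- c))"
proof -
  have "homologous_rel_set p X S c \<in> carrier (relative_homology_group (int p) X S)"
    using assms by (simp add: generates_group_def)
  then have "inv\<^bsub>relative_homology_group (int p) X S\<^esub> (homologous_rel_set p X S c) = uminus ` homologous_rel_set p X S c"
    by (rule inv_relative_homology_group)
  also have "\<dots> = homologous_rel_set p X S (- c)"
  proof -
    have "homologous_rel p X S c d \<longleftrightarrow> homologous_rel p X S (- c) (- d)" for d
      using singular_relboundary_minus [of p X S "c - d"] by (simp add: homologous_rel_def)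
    then show ?thesis
      by (auto simp: image_iff) (metis add.inverse_inverse)
  qed
  finally show ?thesis
    using generates_group_inv [OF _ assms(2)] by simp
qed

text \<open>The homotopy slides every point along its vertical line to height r; the hypotheses say
  that the nonempty fibres of \<open>C\<close> and \<open>D\<close> are star-shaped about r.
  Tracking \<open>D\<close> makes it a homotopy of pairs.\<close>

lemma homotopic_with_vertical:
  assumes C: "\<And>y s u. \<lbrakk>(y, s) \<in> C; 0 \<le> u; u \<le> 1\<rbrakk> \<Longrightarrow> (y, (1 - u) * r + u * s) \<in> C"
    and D: "\<And>y s u. \<lbrakk>(y, s) \<in> D; 0 \<le> u; u \<le> 1\<rbrakk> \<Longrightarrow> (y, (1 - u) * r + u * s) \<in> D"
  shows "homotopic_with (\<lambda>h. h \<in> D \<rightarrow> D) (subtopology (prod_topology M euclideanreal) C)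
           (subtopology (prod_topology M euclideanreal) C) (\<lambda>z. (fst z, r)) id"
proof -
  let ?Y = "subtopology (prod_topology M euclideanreal) C"
  let ?P = "prod_topology (top_of_set {0..1::real}) ?Y"
  define h where "h = (\<lambda>(u::real, z::'a \<times> real). (fst z, (1 - u) * r + u * snd z))"
  have fstc: "continuous_map ?P euclideanreal fst"
    using continuous_map_fst continuous_map_into_fulltopology by blast
  have sndc: "continuous_map ?P (prod_topology M euclideanreal) snd"
    using continuous_map_snd continuous_map_into_fulltopology by blast
  have "continuous_map ?P M (fst \<circ> snd)" "continuous_map ?P euclideanreal (snd \<circ> snd)"
    using continuous_map_compose [OF sndc continuous_map_fst] continuous_map_compose [OF sndc continuous_map_snd]
    by auto
  then have "continuous_map ?P (prod_topology M euclideanreal) (\<lambda>w. (fst (snd w), (1 - fst w) * r + fst w * snd (snd w)))"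
    using fstc by (auto simp: continuous_map_pairwise o_def intro!: continuous_intros)
  moreover have "h w \<in> C" if "w \<in> topspace ?P" for w
    using that C [of "fst (snd w)" "snd (snd w)" "fst w"] by (auto simp: h_def)
  moreover have "h = (\<lambda>w. (fst (snd w), (1 - fst w) * r + fst w * snd (snd w)))"
    by (auto simp: h_def fun_eq_iff)
  ultimately have "continuous_map ?P ?Y h"
    by (simp add: continuous_map_in_subtopology image_subset_iff)
  moreover have "h (u, z) \<in> D" if "u \<in> {0..1}" "z \<in> D" for u z
    using that D [of "fst z" "snd z" u] by (simp add: h_def)
  ultimately show ?thesis
    unfolding homotopic_with_def by (intro exI [of _ h]) (auto simp: h_def)
qed

lemma continuous_map_level: "continuous_map M (prod_topology M euclideanreal) (\<lambda>y. (y, r))"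
  by (simp add: continuous_map_pairwise o_def)

text \<open>
  The generator is transported along
  \<open>H\<^bsub>n+1\<^esub>(X, S) \<rightarrow> H\<^sub>n(S, T) \<leftarrow> H\<^sub>n(B, B \<inter> T) \<leftarrow> H\<^sub>n(M, M - {x})\<close>: the first map is an isomorphism by the
  exact sequence of the triple since \<open>T \<subseteq> X\<close> is a homotopy equivalence, the second excises
  \<open>{x} \<times> (t, \<infinity>)\<close>, and the third is the inclusion at a level below \<open>t\<close>.
\<close>

context
  fixes M :: "'a topology" and x :: 'a and t :: real
    and X S T
  defines "X \<equiv> prod_topology M euclideanreal"
    and "S \<equiv> topspace X - {(x, t)}"
    and "T \<equiv> {z \<in> topspace X. fst z \<noteq> x \<or> t < snd z}"
begin

text \<open>Height t + 1 lies in \<open>T\<close> on every vertical line, and sliding towards it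
  preserves \<open>T\<close>, so \<open>X\<close> and \<open>T\<close> deform onto the same
  level.\<close>

lemma trivial_relative_homology_upper: "trivial_group (relative_homology_group p X T)"
proof (rule trivial_relative_homology_group_gen)
  let ?f = "\<lambda>z::'a \<times> real. (fst z, t + 1)"
  have "continuous_map X X ?f"
    by (simp add: X_def continuous_map_pairwise o_def continuous_map_fst)
  then show "continuous_map X (subtopology X T) ?f"
    by (auto simp: continuous_map_in_subtopology T_def X_def)
  have seg: "t < (1 - u) * (t + 1) + u * s" if "t < s" "0 \<le> u" "u \<le> 1" for u s
  proof -
    have "(1 - u) * t + u * t < (1 - u) * (t + 1) + u * s"
      using that by (cases "u = 0") (auto intro!: add_le_less_mono mult_left_mono)
    then show ?thesis
      by (simp add: algebra_simps)
  qed
  show "homotopic_with (\<lambda>h. True) (subtopology X T) (subtopology X T) ?f id"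
    using homotopic_with_vertical [of T "t + 1" "{}" M] seg by (auto simp: X_def T_def)
  show "homotopic_with (\<lambda>k. True) X X ?f id"
    using homotopic_with_vertical [of UNIV "t + 1" "{}" M] by (simp add: X_def)
qed

lemma hom_relboundary_iso:
  "hom_relboundary (int (Suc n)) X S T
     \<in> iso (relative_homology_group (int (Suc n)) X S) (relative_homology_group (int n) (subtopology X S) T)"
proof (rule very_short_exact_sequence)
  have "T \<subseteq> S"
    by (auto simp: S_def T_def)
  then show "exact_seq ([relative_homology_group (int n) X T, relative_homology_group (int n) (subtopology X S) T,
      relative_homology_group (int (Suc n)) X S, relative_homology_group (int (Suc n)) X T],
      [hom_induced (int n) (subtopology X S) T X T id, hom_relboundary (int (Suc n)) X S T,
       hom_induced (int (Suc n)) X T X S id])"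
    using homology_exactness_triple_1 [of T S "int (Suc n)" X]
      homology_exactness_triple_2 [of T S "int (Suc n)" X]
    by (simp add: exact_seq_cons_iff)
qed (rule trivial_relative_homology_upper)+

lemma hom_induced_level_iso:
  assumes "closedin M {x}" "a < t"
  shows "hom_induced p M (topspace M - {x}) (subtopology X S) T (\<lambda>y. (y, a))
           \<in> iso (relative_homology_group p M (topspace M - {x})) (relative_homology_group p (subtopology X S) T)"
proof -
  \<comment> \<open>Removing \<open>U\<close>, the ray over \<open>x\<close> above t, turns
    \<open>S\<close> into \<open>B\<close> and \<open>T\<close> into \<open>N\<close>. Both slide
    vertically to level a, where they become \<open>M\<close> and \<open>M\<close> without
    \<open>x\<close>.\<close>
  define B where "B = {z \<in> topspace X. fst z \<noteq> x \<or> snd z < t}"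
  define N where "N = {z \<in> topspace X. fst z \<noteq> x}"
  define U where "U = {z \<in> topspace X. fst z = x \<and> t < snd z}"
  let ?i = "\<lambda>y::'a. (y, a)"
  have x: "x \<in> topspace M"
    using assms closedin_subset by blast
  have seg: "(1 - u) * a + u * s < t" if "s < t" "0 \<le> u" "u \<le> 1" for u s
  proof -
    have "(1 - u) * a + u * s < (1 - u) * t + u * t"
      using that assms by (cases "u = 0") (auto intro!: add_le_less_mono mult_left_mono)
    then show ?thesis
      by (simp add: algebra_simps)
  qed
  have iB: "continuous_map M (subtopology X B) ?i"
    using assms continuous_map_level [of M a] by (auto simp: continuous_map_in_subtopology X_def B_def)
  have 1: "hom_induced p M (topspace M - {x}) (subtopology X B) N ?i
      \<in> iso (relative_homology_group p M (topspace M - {x})) (relative_homology_group p (subtopology X B) N)"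
  proof (rule homotopy_equivalence_relative_homology_group_isomorphism)
    show "continuous_map (subtopology X B) M fst"
      by (simp add: X_def continuous_map_from_subtopology continuous_map_fst)
    show "homotopic_with (\<lambda>h. h \<in> topspace M - {x} \<rightarrow> topspace M - {x}) M M (fst \<circ> ?i) id"
      by (simp add: o_def id_def Pi_def)
    have "homotopic_with (\<lambda>h. h \<in> N \<rightarrow> N) (subtopology X B) (subtopology X B) (\<lambda>z. (fst z, a)) id"
      unfolding X_def by (rule homotopic_with_vertical) (use seg in \<open>auto simp: B_def N_def X_def\<close>)
    then show "homotopic_with (\<lambda>k. k \<in> N \<rightarrow> N) (subtopology X B) (subtopology X B) (?i \<circ> fst) id"
      by (simp add: o_def)
  qed (use iB in \<open>auto simp: N_def X_def\<close>)
  let ?X' = "subtopology X S"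
  have topX': "topspace ?X' = S"
    by (auto simp: S_def)
  have 2: "hom_induced p (subtopology ?X' (S - U)) (T - U) (subtopology ?X' S) T id
    \<in> iso (relative_homology_group p (subtopology ?X' (S - U)) (T - U))
          (relative_homology_group p (subtopology ?X' S) T)"
  proof (rule homology_excision_axiom)
    show "T \<subseteq> S"
      by (auto simp: S_def T_def)
    \<comment> \<open>The ray \<open>U\<close> lacks its endpoint (x, t), but exactly this point is
      missing from \<open>S\<close>, so \<open>U\<close> is closed in \<open>S\<close> as the trace
      of the closed ray.\<close>
    have "closedin X ({x} \<times> {t..})"
      unfolding X_def using assms by (simp add: closedin_prod_Times_iff)
    moreover have "U = S \<inter> ({x} \<times> {t..})"
      using x by (auto simp: U_def S_def X_def less_le)
    ultimately have "closedin ?X' U"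
      by (simp add: closedin_subtopology_Int_closed)
    then have clU: "?X' closure_of U = U"
      by (simp add: closure_of_eq)
    have "closedin X ({x} \<times> {..t})"
      unfolding X_def using assms by (simp add: closedin_prod_Times_iff)
    then have "openin X (topspace X - {x} \<times> {..t})"
      by blast
    moreover have "T = topspace X - {x} \<times> {..t}"
      using x by (auto simp: T_def X_def)
    ultimately have "openin X T"
      by simp
    then have "openin ?X' T"
      using \<open>T \<subseteq> S\<close> by (metis inf.absorb_iff2 openin_subtopology_Int2)
    then have "?X' interior_of T = T"
      by (simp add: interior_of_eq)
    with clU show "?X' closure_of U \<subseteq> ?X' interior_of T"
      by (auto simp: U_def T_def)
  qed
  have eqs: "subtopology ?X' (S - U) = subtopology X B" "T - U = N" "subtopology ?X' S = ?X'"
  proof -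
    have "S \<inter> (S - U) = B"
      by (auto simp: S_def U_def B_def X_def)
    then show "subtopology ?X' (S - U) = subtopology X B"
      by (simp add: subtopology_subtopology)
    show "T - U = N"
      by (auto simp: T_def U_def N_def)
    show "subtopology ?X' S = ?X'"
      by (simp add: subtopology_subtopology)
  qed
  have BS: "subtopology X B = subtopology ?X' B"
  proof -
    have "S \<inter> B = B"
      by (auto simp: S_def B_def)
    then show ?thesis
      by (simp add: subtopology_subtopology)
  qed
  have "hom_induced p M (topspace M - {x}) ?X' T ?i =
      hom_induced p (subtopology X B) N ?X' T id \<circ> hom_induced p M (topspace M - {x}) (subtopology X B) N ?i"
  proof -
    have "continuous_map (subtopology X B) ?X' id"
      unfolding BS by (simp add: continuous_map_from_subtopology)
    then have "hom_induced p M (topspace M - {x}) ?X' T (id \<circ> ?i) =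
      hom_induced p (subtopology X B) N ?X' T id \<circ> hom_induced p M (topspace M - {x}) (subtopology X B) N ?i"
      by (intro hom_induced_compose iB) (auto simp: N_def T_def X_def)
    then show ?thesis
      by simp
  qed
  then show ?thesis
    using iso_set_trans [OF 1 2 [unfolded eqs]] by simp
qed

text \<open>Only the boundary of \<open>C\<close> enters. Modulo \<open>T\<close> the copy of
  \<open>c\<close> at height b vanishes, since it lies above t, and the copy at height a remains
  with a minus sign; it corresponds to a generator of the local homology of
  \<open>M\<close>.\<close>

lemma generates_local_homology:
  assumes "closedin M {x}" "a < t" "t < b"
    and c: "singular_relcycle n M {} c"
    and gen: "generates_group (relative_homology_group (int n) M (topspace M - {x}))
                (homologous_rel_set n M (topspace M - {x}) c)"
    and C: "singular_chain (Suc n) X C"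
    and bd: "chain_boundary (Suc n) C = chain_map n (\<lambda>y. (y, b)) c - chain_map n (\<lambda>y. (y, a)) c"
  shows "generates_group (relative_homology_group (int (Suc n)) X S) (homologous_rel_set (Suc n) X S C)"
proof -
  let ?X' = "subtopology X S"
  let ?a = "\<lambda>y::'a. (y, a)" and ?b = "\<lambda>y::'a. (y, b)"
  let ?d = "hom_relboundary (int (Suc n)) X S T"
  let ?f = "hom_induced (int n) M (topspace M - {x}) ?X' T ?a"
  have cch: "singular_chain n M c"
    using c by (simp add: singular_cycle)
  have crel: "singular_relcycle n M (topspace M - {x}) c"
    using c unfolding singular_cycle by (simp add: singular_relcycle)
  have ca: "continuous_map M ?X' ?a" "continuous_map M ?X' ?b" "continuous_map M (subtopology X T) ?b"
    using assms continuous_map_level [of M] by (auto simp: continuous_map_in_subtopology X_def S_def T_def)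
  have chains: "singular_chain n ?X' (chain_map n ?a c)" "singular_chain n ?X' (chain_map n ?b c)"
    "singular_chain n (subtopology X T) (chain_map n ?b c)"
    using ca cch singular_chain_chain_map by blast+
  have Ccyc: "singular_relcycle (Suc n) X S C"
    using C chains by (simp add: singular_relcycle bd singular_chain_diff)
  have bdcyc: "singular_relcycle n ?X' {} (chain_boundary (Suc n) C)"
    using Ccyc C chain_boundary_boundary [of "Suc n" X C] by (simp add: singular_cycle singular_relcycle)
  have "?d (homologous_rel_set (Suc n) X S C) =
      hom_induced (int n) ?X' {} ?X' T id (homologous_rel_set n ?X' {} (chain_boundary (Suc n) C))"
    using hom_boundary_chain_boundary [OF Ccyc] by (simp add: hom_relboundary_def)
  also have "\<dots> = homologous_rel_set n ?X' T (chain_map n id (chain_boundary (Suc n) C))"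
    using bdcyc by (intro hom_induced_chain_map) auto
  also have "chain_map n id (chain_boundary (Suc n) C) = chain_boundary (Suc n) C"
    using bdcyc by (intro chain_map_id_gen [of n ?X']) (auto simp: singular_cycle)
  also have "homologous_rel_set n ?X' T (chain_boundary (Suc n) C) = homologous_rel_set n ?X' T (chain_map n ?a (- c))"
  proof -
    have "S \<inter> T = T"
      by (auto simp: S_def T_def)
    then have "singular_chain n (subtopology ?X' T) (chain_map n ?b c)"
      using chains by (simp add: subtopology_subtopology)
    then have "homologous_rel n ?X' T (chain_boundary (Suc n) C) (chain_map n ?a (- c))"
      unfolding homologous_rel_def bd by (intro singular_chain_imp_relboundary) (simp add: chain_map_minus)
    then show ?thesis
      by (metis homologous_rel_set_eq)
  qed
  also have "\<dots> = ?f (homologous_rel_set n M (topspace M - {x}) (- c))"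
  proof (rule hom_induced_chain_map [symmetric])
    show "singular_relcycle n M (topspace M - {x}) (- c)"
      using crel by (simp add: singular_relcycle_minus)
  qed (use ca in \<open>auto simp: T_def X_def\<close>)
  finally have eq: "?d (homologous_rel_set (Suc n) X S C) = ?f (homologous_rel_set n M (topspace M - {x}) (- c))" .
  have gen': "generates_group (relative_homology_group (int n) M (topspace M - {x}))
                (homologous_rel_set n M (topspace M - {x}) (- c))"
    using crel gen by (rule generates_homology_minus)
  then have "generates_group (relative_homology_group (int n) ?X' T) (?f (homologous_rel_set n M (topspace M - {x}) (- c)))"
    using generates_group_iso [OF hom_induced_level_iso [OF assms(1,2)]] by (simp add: generates_group_def)
  then have "generates_group (relative_homology_group (int n) ?X' T) (?d (homologous_rel_set (Suc n) X S C))"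
    by (simp only: eq)
  moreover have "homologous_rel_set (Suc n) X S C \<in> carrier (relative_homology_group (int (Suc n)) X S)"
    using Ccyc unfolding carrier_relative_homology_group by blast
  ultimately show ?thesis
    using generates_group_iso [OF hom_relboundary_iso] by simp
qed

end


subsection \<open>Products of manifolds with a line\<close>

lemma second_countable_prod_topology:
  assumes "second_countable X" "second_countable Y"
  shows "second_countable (prod_topology X Y)"
proof -
  obtain \<B> where B: "countable \<B>" "\<And>V. V \<in> \<B> \<Longrightarrow> openin X V"
    "\<And>U x. \<lbrakk>openin X U; x \<in> U\<rbrakk> \<Longrightarrow> \<exists>V\<in>\<B>. x \<in> V \<and> V \<subseteq> U"
    using assms(1) unfolding second_countable_def by metis
  obtain \<C> where C: "countable \<C>" "\<And>V. V \<in> \<C> \<Longrightarrow> openin Y V"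
    "\<And>U x. \<lbrakk>openin Y U; x \<in> U\<rbrakk> \<Longrightarrow> \<exists>V\<in>\<C>. x \<in> V \<and> V \<subseteq> U"
    using assms(2) unfolding second_countable_def by metis
  let ?D = "(\<lambda>(U, V). U \<times> V) ` (\<B> \<times> \<C>)"
  have "\<exists>V\<in>?D. z \<in> V \<and> V \<subseteq> U" if U: "openin (prod_topology X Y) U" "z \<in> U" for U z
  proof -
    obtain S T where "openin X S" "openin Y T" "fst z \<in> S" "snd z \<in> T" "S \<times> T \<subseteq> U"
      using U openin_prod_topology_alt [of X Y U] by (metis prod.collapse)
    moreover obtain S' T' where "S' \<in> \<B>" "fst z \<in> S'" "S' \<subseteq> S" "T' \<in> \<C>" "snd z \<in> T'" "T' \<subseteq> T"
      using B(3) C(3) calculation by meson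
    ultimately have "S' \<times> T' \<in> ?D" "z \<in> S' \<times> T'" "S' \<times> T' \<subseteq> U"
      by (auto simp: mem_Times_iff)
    then show ?thesis
      by blast
  qed
  moreover have "openin (prod_topology X Y) V" if "V \<in> ?D" for V
    using that B(2) C(2) by (auto simp: openin_prod_Times_iff)
  ultimately show ?thesis
    using B(1) C(1) unfolding second_countable_def by (intro exI [of _ ?D]) auto
qed

lemma second_countable_euclideanreal: "second_countable euclideanreal"
proof -
  obtain \<B> :: "real set set" where B: "countable \<B>" "\<And>C. C \<in> \<B> \<Longrightarrow> open C"
    "\<And>S. open S \<Longrightarrow> \<exists>U. U \<subseteq> \<B> \<and> S = \<Union>U"
    using univ_second_countable by blast
  have "\<exists>V\<in>\<B>. x \<in> V \<and> V \<subseteq> U" if U: "open U" "x \<in> U" for U and x :: real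
  proof -
    obtain \<U> where "\<U> \<subseteq> \<B>" "U = \<Union>\<U>"
      using B(3) [OF U(1)] by blast
    then show ?thesis
      using U(2) by blast
  qed
  then show ?thesis
    using B(1,2) unfolding second_countable_def by (intro exI [of _ \<B>]) simp
qed

text \<open>Points of \<open>Euclidean_space n\<close> are sequences vanishing from place n on, so
  the line factor is stored in place n: \<open>g\<close> writes it there and \<open>f\<close> erases
  it.\<close>

lemma Euclidean_space_prod_line:
  assumes "openin (Euclidean_space n) W"
  obtains W' where "openin (Euclidean_space (Suc n)) W'"
    "prod_topology (subtopology (Euclidean_space n) W) euclideanreal homeomorphic_space
       subtopology (Euclidean_space (Suc n)) W'"
proof -
  let ?E = "Euclidean_space n" and ?E' = "Euclidean_space (Suc n)"
  let ?P = "prod_topology (subtopology ?E W) euclideanreal"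
  define f :: "(nat \<Rightarrow> real) \<Rightarrow> nat \<Rightarrow> real" where "f = (\<lambda>x. x(n := 0))"
  define g :: "(nat \<Rightarrow> real) \<times> real \<Rightarrow> nat \<Rightarrow> real" where "g = (\<lambda>z. (fst z)(n := snd z))"
  define W' where "W' = {x \<in> topspace ?E'. f x \<in> W}"
  have coord: "continuous_map ?E' euclideanreal (\<lambda>x. x i)" for i
    unfolding Euclidean_space_def
    by (intro continuous_map_from_subtopology continuous_map_product_projection) auto
  have f: "continuous_map ?E' ?E f"
    unfolding Euclidean_space_def [of n]
    by (auto simp: continuous_map_in_subtopology continuous_map_componentwise f_def coord
        topspace_Euclidean_space)
  then have W': "openin ?E' W'"
    unfolding W'_def using assms by (rule openin_continuous_map_preimage)
  have "continuous_map ?P euclideanreal (\<lambda>z. fst z i)" for i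
  proof -
    have "continuous_map ?E euclideanreal (\<lambda>x. x i)"
      unfolding Euclidean_space_def
      by (intro continuous_map_from_subtopology continuous_map_product_projection) auto
    then have "continuous_map ?P euclideanreal ((\<lambda>x. x i) \<circ> fst)"
      using continuous_map_compose [OF continuous_map_fst] continuous_map_from_subtopology by blast
    then show ?thesis
      by (simp add: o_def)
  qed
  then have "continuous_map ?P (powertop_real UNIV) g"
    unfolding continuous_map_componentwise
    by (auto simp: g_def continuous_map_snd fun_upd_def)
  moreover have W_sub: "W \<subseteq> topspace ?E"
    using assms openin_subset by blast
  moreover have fg: "f (g z) = fst z" if "z \<in> topspace ?P" for z
    using that by (auto simp: f_def g_def topspace_Euclidean_space)
  ultimately have g: "continuous_map ?P (subtopology ?E' W') g"
    using W_sub unfolding Euclidean_space_def [of "Suc n"]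
    by (auto simp: continuous_map_in_subtopology W'_def g_def f_def topspace_Euclidean_space)
  have "continuous_map (subtopology ?E' W') ?P (\<lambda>x. (f x, x n))"
    using f coord
    by (auto simp: continuous_map_pairwise o_def continuous_map_in_subtopology continuous_map_from_subtopology W'_def)
  moreover have "g (f x, x n) = x" for x
    by (auto simp: f_def g_def)
  moreover have "(f (g z), g z n) = z" if "z \<in> topspace ?P" for z
    using fg [OF that] by (simp add: g_def prod_eq_iff)
  ultimately have "homeomorphic_maps ?P (subtopology ?E' W') g (\<lambda>x. (f x, x n))"
    using g by (simp add: homeomorphic_maps_def)
  then show ?thesis
    using that W' homeomorphic_maps_imp_homeomorphic_space by blast
qed

lemma manifold_prod_line:
  assumes "manifold n M"
  shows "manifold (Suc n) (prod_topology M euclideanreal)"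
  unfolding manifold_def
proof (intro conjI ballI)
  show "Hausdorff_space (prod_topology M euclideanreal)"
    using assms by (simp add: manifold_def Hausdorff_space_prod_topology)
  show "second_countable (prod_topology M euclideanreal)"
    using assms by (simp add: manifold_def second_countable_prod_topology second_countable_euclideanreal)
  fix z assume "z \<in> topspace (prod_topology M euclideanreal)"
  then have "fst z \<in> topspace M"
    by auto
  then obtain U W where U: "openin M U" "fst z \<in> U" "openin (Euclidean_space n) W"
    and h: "subtopology M U homeomorphic_space subtopology (Euclidean_space n) W"
    using assms unfolding manifold_def by blast
  obtain W' where W': "openin (Euclidean_space (Suc n)) W'"
    "prod_topology (subtopology (Euclidean_space n) W) euclideanreal homeomorphic_space
       subtopology (Euclidean_space (Suc n)) W'"
    using Euclidean_space_prod_line U(3) by blast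
  have "subtopology (prod_topology M euclideanreal) (U \<times> UNIV) = prod_topology (subtopology M U) euclideanreal"
    by (simp add: subtopology_Times)
  also have "\<dots> homeomorphic_space prod_topology (subtopology (Euclidean_space n) W) euclideanreal"
    using h by (simp add: homeomorphic_space_prod_topology homeomorphic_space_refl)
  also have "\<dots> homeomorphic_space subtopology (Euclidean_space (Suc n)) W'"
    by (rule W')
  finally show "\<exists>V W. openin (prod_topology M euclideanreal) V \<and> z \<in> V \<and> openin (Euclidean_space (Suc n)) W \<and>
      subtopology (prod_topology M euclideanreal) V homeomorphic_space subtopology (Euclidean_space (Suc n)) W"
    using U W' by (intro exI [of _ "U \<times> UNIV"] exI [of _ W']) (auto simp: openin_prod_Times_iff mem_Times_iff)
qed

text \<open>Already \<open>slab M 0\<close> contains height 0, so that the step cocycle vanishes off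
  every slab.\<close>

definition slab :: "'a topology \<Rightarrow> nat \<Rightarrow> ('a \<times> real) set" where
  "slab M i = topspace M \<times> {- (real i + 1)..real i + 1}"

lemma slab_cofinal:
  assumes "fst z \<in> topspace M"
  obtains i where "z \<in> slab M i"
proof -
  obtain i where "\<bar>snd z\<bar> \<le> real i"
    using real_arch_simple by blast
  then have "z \<in> slab M i"
    using assms by (auto simp: slab_def mem_Times_iff)
  then show ?thesis
    by (rule that)
qed

lemma exhaustion_slab:
  assumes "compact_space M"
  shows "exhaustion (prod_topology M euclideanreal) (slab M)"
  unfolding exhaustion_def
proof (intro conjI allI)
  show "compactin (prod_topology M euclideanreal) (slab M i)" for i
  proof -
    have "compactin M (topspace M)"
      using assms by (simp only: compact_space_def)
    then show ?thesis
      by (simp add: slab_def compactin_Times)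
  qed
  show "slab M i \<subseteq> prod_topology M euclideanreal interior_of slab M (Suc i)" for i
  proof -
    have "topspace M \<times> {- (real i + 2)<..<real i + 2} \<subseteq> prod_topology M euclideanreal interior_of slab M (Suc i)"
      by (rule interior_of_maximal) (auto simp: slab_def openin_prod_Times_iff)
    moreover have "slab M i \<subseteq> topspace M \<times> {- (real i + 2)<..<real i + 2}"
      by (auto simp: slab_def)
    ultimately show ?thesis
      by blast
  qed
  show "(\<Union>i. slab M i) = topspace (prod_topology M euclideanreal)"
  proof
    show "topspace (prod_topology M euclideanreal) \<subseteq> (\<Union>i. slab M i)"
    proof
      fix z assume "z \<in> topspace (prod_topology M euclideanreal)"
      then have "fst z \<in> topspace M"
        by auto
      then show "z \<in> (\<Union>i. slab M i)"
        by (elim slab_cofinal) blast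
    qed
  qed (auto simp: slab_def)
qed


subsection \<open>The fundamental class of a product with a line\<close>

text \<open>The prisms fill the heights from -N to N, and enlarging N adds only an outermost pair;
  this makes the towers a compatible family at the ends.\<close>

definition tower :: "nat \<Rightarrow> 'a chain \<Rightarrow> nat \<Rightarrow> ('a \<times> real) chain" where
  "tower n c N = (\<Sum>k<N. prism n (real k) c + prism n (- real k - 1) c)"

lemma singular_chain_prism_avoiding:
  assumes "singular_chain n M c" "{s..s + 1} \<inter> {- (real i + 1)..real i + 1} = {}"
  shows "singular_chain (Suc n) (subtopology (prod_topology M euclideanreal)
           (end_nbhds (slab M) (topspace (prod_topology M euclideanreal)) i)) (prism n s c)"
proof -
  let ?X = "prod_topology M euclideanreal"
  have "singular_chain (Suc n) (subtopology ?X (topspace ?X \<inter> UNIV \<times> {s..s + 1})) (prism n s c)"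
    using singular_chain_prism [OF assms(1), of s] by (metis subtopology_restrict)
  then show ?thesis
    by (rule singular_chain_mono) (use assms(2) in \<open>auto simp: end_nbhds_def slab_def\<close>)
qed

lemma singular_chain_tower:
  assumes "singular_chain n M c"
  shows "singular_chain (Suc n) (prod_topology M euclideanreal) (tower n c N)"
  unfolding tower_def
  using assms singular_chain_prism singular_chain_subtopology
  by (intro singular_chain_sum singular_chain_add) blast+

lemma chain_boundary_tower:
  assumes "singular_relcycle n M {} c" "n > 0"
  shows "chain_boundary (Suc n) (tower n c N) =
           chain_map n (\<lambda>x. (x, real N)) c - chain_map n (\<lambda>x. (x, - real N)) c"
proof -
  define f where "f r = chain_map n (\<lambda>x. (x, r)) c" for r :: real
  have "chain_boundary n c = 0"
    using assms by (simp add: singular_cycle)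
  then have P: "chain_boundary (Suc n) (prism n s c) = f (s + 1) - f s" for s
    using assms by (simp add: chain_boundary_prism f_def)
  have "chain_boundary (Suc n) (tower n c N) = f (real N) - f (- real N)"
  proof (induction N)
    case 0
    then show ?case
      by (simp add: tower_def)
  next
    case (Suc N)
    have "f (- real N - 1) = f (- real (Suc N))" "f (real N + 1) = f (real (Suc N))"
      by (auto intro!: arg_cong [of _ _ f])
    then show ?case
      using Suc by (simp add: tower_def chain_boundary_add P del: of_nat_Suc)
  qed
  then show ?thesis
    by (simp add: f_def)
qed

lemma tower_cap_step:
  assumes "singular_chain n M c" "N > 0"
  shows "chain_cap 1 n (tower n c N) (step_cocycle M) = chain_map n (\<lambda>x. (x, 0)) c"
proof -
  have "chain_cap 1 n (tower n c N) (step_cocycle M) =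
      (\<Sum>k<N. if k = 0 then chain_map n (\<lambda>x. (x, 0)) c else 0)"
    unfolding tower_def chain_cap_sum
  proof (intro sum.cong refl)
    fix k
    \<comment> \<open>The lower prism over [-k - 1, -k] crosses the step only if its top reaches
      height 0, that is, for k = 0. The upper prisms never cross it, since even their bottoms have
      height at least 0.\<close>
    have "(0 \<le> - real k) \<longleftrightarrow> k = 0"
      by auto
    then show "chain_cap 1 n (prism n (real k) c + prism n (- real k - 1) c) (step_cocycle M) =
        (if k = 0 then chain_map n (\<lambda>x. (x, 0)) c else 0)"
      by (simp add: chain_cap_add prism_cap_step [OF assms(1)] del: One_nat_def)
  qed
  then show ?thesis
    using assms by (simp add: sum.delta)
qed

text \<open>The offset 2 puts the boundary of the j-th tower at heights j + 2 and -(j + 2), strictly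
  outside slab j, which ends at j + 1; the same margin keeps the prisms added later outside slab
  j.\<close>

lemma lim_cycle_tower:
  assumes "singular_relcycle n M {} c" "n > 0"
  shows "lim_cycle (Suc n) (prod_topology M euclideanreal)
           (end_nbhds (slab M) (topspace (prod_topology M euclideanreal))) (\<lambda>j. tower n c (j + 2))"
proof -
  let ?X = "prod_topology M euclideanreal"
  let ?W = "end_nbhds (slab M) (topspace ?X)"
  have c: "singular_chain n M c"
    using assms by (simp add: singular_cycle)
  have "singular_chain (Suc n) (subtopology ?X (?W j)) (tower n c (Suc j + 2) - tower n c (j + 2))" for j
    using singular_chain_prism_avoiding [OF c, of "real (j + 2)" j]
      singular_chain_prism_avoiding [OF c, of "- real (j + 2) - 1" j]
    by (simp add: tower_def singular_chain_add)
  moreover have "singular_relcycle (Suc n) ?X (?W j) (tower n c (j + 2))" for j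
  proof -
    have "singular_chain n (subtopology ?X (?W j)) (chain_map n (\<lambda>x. (x, r)) c)"
      if "\<bar>r\<bar> = real (j + 2)" for r
    proof (rule singular_chain_chain_map [OF c])
      show "continuous_map M (subtopology ?X (?W j)) (\<lambda>x. (x, r))"
        using that continuous_map_level [of M r]
        by (auto simp: continuous_map_in_subtopology end_nbhds_def slab_def)
    qed
    then show ?thesis
      using c assms
      by (simp add: singular_relcycle singular_chain_tower chain_boundary_tower singular_chain_diff)
  qed
  ultimately show ?thesis
    using c by (simp add: lim_cycle_def lim_chain_def singular_chain_tower)
qed

lemma hom_induced_id_class:
  assumes "singular_relcycle p X A c" "A \<subseteq> B"
  shows "hom_induced (int p) X A X B id (homologous_rel_set p X A c) = homologous_rel_set p X B c"
proof -
  have "chain_map p id c = c"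
    using assms by (intro chain_map_id_gen [of p X]) (auto simp: singular_relcycle)
  then show ?thesis
    using hom_induced_chain_map [of X X id A B p c] assms by (simp add: subset_iff)
qed

text \<open>Local consistency is automatic: over the interior of \<open>K (Suc i)\<close> all local
  classes are restrictions of the single chain \<open>C (Suc i)\<close>. What remains to be supplied
  is that they are generators.\<close>

lemma orientation_of_lim_cycle:
  assumes K: "exhaustion X K"
    and C: "lim_cycle p X (end_nbhds K (topspace X)) C"
    and gen: "\<And>x i. x \<in> K i \<Longrightarrow>
      generates_group (relative_homology_group (int p) X (topspace X - {x}))
        (homologous_rel_set p X (topspace X - {x}) (C i))"
  obtains \<omega> where "orientation p X \<omega>"
    "fundamental_class p X K \<omega> (lim_homologous p X (end_nbhds K (topspace X)) `` {C})"
proof -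
  let ?W = "end_nbhds K (topspace X)"
  \<comment> \<open>The least stage containing \<open>x\<close> fixes a choice; the fact
    \<open>\<omega>\<close> below shows that every stage containing \<open>x\<close> gives the same
    class.\<close>
  define \<omega> where "\<omega> x = homologous_rel_set p X (topspace X - {x}) (C (LEAST i. x \<in> K i))" for x
  have mono: "antimono ?W"
    by (rule antimono_end_nbhds [OF K])
  have C_cyc: "singular_relcycle p X (?W i) (C i)" for i
    using C by (simp add: lim_cycle_def)
  have \<omega>: "homologous_rel_set p X (topspace X - {x}) (C i) = \<omega> x" if "x \<in> K i" for x i
  proof -
    let ?l = "LEAST i. x \<in> K i"
    have l: "x \<in> K ?l" "?l \<le> i"
      using that by (auto intro: LeastI Least_le)
    then have "singular_chain p (subtopology X (?W ?l)) (C i - C ?l)"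
      using C mono lim_chain_add unfolding lim_cycle_def by blast
    then have "singular_chain p (subtopology X (topspace X - {x})) (C i - C ?l)"
      by (rule singular_chain_mono) (use l in \<open>auto simp: end_nbhds_def\<close>)
    then have "homologous_rel p X (topspace X - {x}) (C i) (C ?l)"
      unfolding homologous_rel_def by (rule singular_chain_imp_relboundary)
    then show ?thesis
      unfolding \<omega>_def by (metis homologous_rel_set_eq)
  qed
  have cover: "\<exists>i. x \<in> K i" if "x \<in> topspace X" for x
    using K that by (auto simp: exhaustion_def)
  have "orientation p X \<omega>"
    unfolding orientation_def
  proof (intro conjI ballI)
    fix x assume "x \<in> topspace X"
    then obtain i where i: "x \<in> K i"
      using cover by blast
    then show "generates_group (relative_homology_group (int p) X (topspace X - {x})) (\<omega> x)"
      using gen [OF i] \<omega> [OF i] by simp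
    \<comment> \<open>Stage \<open>Suc i\<close> is taken because the exhaustion makes
      \<open>x\<close> an interior point there.\<close>
    let ?U = "X interior_of K (Suc i)"
    let ?a = "homologous_rel_set p X (topspace X - ?U) (C (Suc i))"
    have U: "?U \<subseteq> K (Suc i)"
      by (rule interior_of_subset)
    have "singular_relcycle p X (topspace X - ?U) (C (Suc i))"
      using C_cyc [of "Suc i"] singular_chain_mono [of _ X "?W (Suc i)" _ "topspace X - ?U"] U
      by (auto simp: singular_relcycle end_nbhds_def)
    moreover have "hom_induced (int p) X (topspace X - ?U) X (topspace X - {y}) id ?a = \<omega> y" if "y \<in> ?U" for y
    proof -
      have "hom_induced (int p) X (topspace X - ?U) X (topspace X - {y}) id ?a =
          homologous_rel_set p X (topspace X - {y}) (C (Suc i))"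
        by (rule hom_induced_id_class) (use calculation that in auto)
      then show ?thesis
        using \<omega> [of y "Suc i"] that U by auto
    qed
    moreover have "x \<in> ?U"
      using K i by (auto simp: exhaustion_def)
    ultimately show "\<exists>U. openin X U \<and> x \<in> U \<and>
        (\<exists>a\<in>carrier (relative_homology_group (int p) X (topspace X - U)).
           \<forall>y\<in>U. hom_induced (int p) X (topspace X - U) X (topspace X - {y}) id a = \<omega> y)"
      unfolding carrier_relative_homology_group
      by (intro exI [of _ ?U] conjI openin_interior_of bexI [of _ ?a]) auto
  qed
  moreover have "fundamental_class p X K \<omega> (lim_homologous p X ?W `` {C})"
    unfolding fundamental_class_def
  proof (intro conjI allI ballI)
    show "lim_homologous p X ?W `` {C} \<in> lim_homology p X ?W"
      using C by (simp add: lim_homology_def quotientI)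
    fix i x assume x: "x \<in> K i"
    have "hom_induced (int p) X (?W i) X (topspace X - {x}) id (homologous_rel_set p X (?W i) (C i)) =
        homologous_rel_set p X (topspace X - {x}) (C i)"
      by (rule hom_induced_id_class [OF C_cyc]) (use x in \<open>auto simp: end_nbhds_def\<close>)
    then show "hom_induced (int p) X (topspace X - K i) X (topspace X - {x}) id
        (lim_proj p X ?W i (lim_homologous p X ?W `` {C})) = \<omega> x"
      unfolding lim_proj_class [OF C] using \<omega> [OF x] by (simp add: end_nbhds_def)
  qed
  ultimately show ?thesis
    by (rule that)
qed


subsection \<open>Naturality\<close>

text \<open>The guard keeps the pullback normalised to 0 off the simplices of \<open>X\<close>, as
  \<open>singular_cochain\<close> demands.\<close>

definition cochain_pullback :: "nat \<Rightarrow> 'a topology \<Rightarrow> ('a \<Rightarrow> 'b) \<Rightarrow> 'b cochain \<Rightarrow> 'a cochain" where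
  "cochain_pullback p X f \<phi> = (\<lambda>\<sigma>. if singular_simplex p X \<sigma> then \<phi> (simplex_map p f \<sigma>) else 0)"

lemma cochain_eval_pullback:
  assumes "singular_chain p X c"
  shows "cochain_eval (cochain_pullback p X f \<phi>) c = cochain_eval \<phi> (chain_map p f c)"
  using assms unfolding singular_chain_def
proof (induction c rule: frag_induction)
  case (one \<sigma>)
  then show ?case
    by (simp add: cochain_pullback_def)
next
  case (diff a b)
  then show ?case
    by (simp add: cochain_eval_diff chain_map_diff)
qed auto

lemma cochain_coboundary_pullback:
  assumes "continuous_map X Y f"
  shows "cochain_coboundary p X (cochain_pullback p X f \<phi>) =
           cochain_pullback (Suc p) X f (cochain_coboundary p Y \<phi>)"
proof
  fix \<sigma>
  show "cochain_coboundary p X (cochain_pullback p X f \<phi>) \<sigma> =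
           cochain_pullback (Suc p) X f (cochain_coboundary p Y \<phi>) \<sigma>"
  proof (cases "singular_simplex (Suc p) X \<sigma>")
    case True
    then have c: "singular_chain (Suc p) X (frag_of \<sigma>)"
      by (simp add: singular_chain_of)
    then have "singular_chain p X (chain_boundary (Suc p) (frag_of \<sigma>))"
      by (rule singular_chain_boundary_alt)
    moreover have "singular_simplex (Suc p) Y (simplex_map (Suc p) f \<sigma>)"
      using True assms by (rule singular_simplex_simplex_map)
    ultimately show ?thesis
      using True chain_boundary_chain_map [OF c, of f]
      by (simp add: cochain_coboundary_def cochain_eval_pullback) (simp add: cochain_pullback_def)
  qed (simp add: cochain_coboundary_def cochain_pullback_def)
qed

lemma singular_cocycle_pullback:
  assumes "continuous_map X Y f" "singular_cocycle p Y {} \<phi>"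
  shows "singular_cocycle p X {} (cochain_pullback p X f \<phi>)"
  using assms
  by (auto simp: singular_cocycle_def singular_cochain_def cochain_coboundary_pullback singular_simplex_empty)
     (simp_all add: cochain_pullback_def)

lemma cochain_cup_pullback:
  assumes "continuous_map X Y f"
  shows "cochain_cup p q X (cochain_pullback p X f \<phi>) (cochain_pullback q X f \<psi>) =
           cochain_pullback (p + q) X f (cochain_cup p q Y \<phi> \<psi>)"
  using assms singular_simplex_front_face [of "p + q" X _ p] singular_simplex_back_face [of p q X]
  by (auto simp: cochain_cup_def cochain_pullback_def front_face_simplex_map back_face_simplex_map
      singular_simplex_simplex_map)

lemma cochain_cup_list_pullback:
  assumes "continuous_map X Y f"
  shows "cochain_cup_list X (map (cochain_pullback 1 X f) \<phi>s) =
           cochain_pullback (length \<phi>s) X f (cochain_cup_list Y \<phi>s)"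
proof (induction \<phi>s)
  case Nil
  then show ?case
    using singular_simplex_simplex_map [OF _ assms] by (auto simp: cochain_pullback_def)
next
  case (Cons \<phi> \<phi>s)
  then show ?case
    using cochain_cup_pullback [OF assms, of 1 "length \<phi>s"] by simp
qed

text \<open>The projection formula holds already for chains, because front and back faces commute
  with composing a simplex with \<open>f\<close>.\<close>

lemma chain_map_cap_pullback:
  assumes "singular_chain (k + q) X c"
  shows "chain_map q f (chain_cap k q c (cochain_pullback k X f \<phi>)) =
           chain_cap k q (chain_map (k + q) f c) \<phi>"
  using assms unfolding singular_chain_def
proof (induction c rule: frag_induction)
  case (one \<sigma>)
  then have "singular_simplex k X (front_face k \<sigma>)"
    by (auto intro: singular_simplex_front_face)
  then show ?case
    by (simp add: cochain_pullback_def front_face_simplex_map back_face_simplex_map)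
next
  case (diff a b)
  then show ?case
    by (simp add: chain_cap_diff chain_map_diff)
qed auto

text \<open>Composing with \<open>f\<close> sends disc maps to disc maps and sphere maps to sphere
  maps, and a homomorphism carries the generated subgroup onto the one generated by the
  images.\<close>

lemma hurewicz_image_naturality:
  assumes f: "continuous_map X Y f" and "f \<in> A \<rightarrow> B" and u: "u \<in> hurewicz_image X A"
  shows "hom_induced 2 X A Y B f u \<in> hurewicz_image Y B"
proof -
  let ?G = "relative_homology_group 2 X A" and ?H = "relative_homology_group 2 Y B"
  let ?h = "hom_induced 2 X A Y B f"
  interpret group_hom ?G ?H ?h
    by (simp add: group_hom_def group_hom_axioms_def hom_induced_hom)
  let ?S = "disc_classes X A \<union> sphere_classes X A"
  have "?S \<subseteq> carrier ?G"
    by (auto simp: disc_classes_def sphere_classes_def hom_induced_carrier)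
  then have "?h u \<in> carrier (subgroup_generated ?H (?h ` ?S))"
    using u subgroup_generated_by_image unfolding hurewicz_image_def by blast
  moreover have "?h ` disc_classes X A \<subseteq> disc_classes Y B"
  proof clarify
    fix v assume "v \<in> disc_classes X A"
    then obtain g w where g: "v = hom_induced 2 disc2 circle1 X A g w" "continuous_map disc2 X g"
      "g ` circle1 \<subseteq> A" "generates_group (relative_homology_group 2 disc2 circle1) w"
      unfolding disc_classes_def by blast
    then have "?h v = hom_induced 2 disc2 circle1 Y B (f \<circ> g) w"
      using assms by (simp add: hom_induced_compose' image_subset_iff_funcset)
    moreover have "continuous_map disc2 Y (f \<circ> g)" "(f \<circ> g) ` circle1 \<subseteq> B"
      using g assms continuous_map_compose by auto
    ultimately show "?h v \<in> disc_classes Y B"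
      using g unfolding disc_classes_def by blast
  qed
  moreover have "?h ` sphere_classes X A \<subseteq> sphere_classes Y B"
  proof clarify
    fix v assume "v \<in> sphere_classes X A"
    then obtain g w where g: "v = hom_induced 2 (nsphere 2) {} X A g w" "continuous_map (nsphere 2) X g"
      "generates_group (homology_group 2 (nsphere 2)) w"
      unfolding sphere_classes_def by blast
    then have "?h v = hom_induced 2 (nsphere 2) {} Y B (f \<circ> g) w"
      using assms by (simp add: hom_induced_compose')
    moreover have "continuous_map (nsphere 2) Y (f \<circ> g)"
      using g(2) f by (rule continuous_map_compose)
    ultimately show "?h v \<in> sphere_classes Y B"
      using g unfolding sphere_classes_def by blast
  qed
  ultimately show ?thesis
    unfolding hurewicz_image_def carrier_subgroup_generated
    using H.mono_generate [of "carrier ?H \<inter> ?h ` ?S" "carrier ?H \<inter> (disc_classes Y B \<union> sphere_classes Y B)"]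
    by blast
qed


subsection \<open>The product of a closed SYS manifold with a line\<close>

text \<open>For \<open>V = {}\<close> the set \<open>\<Omega> = topspace X\<close> equals the
  complement of \<open>V\<close>, and its own complement is empty; being spherical then tests the
  absolute class.\<close>

lemma spherical_empty_imp_hurewicz:
  assumes "spherical X K {} \<tau>" "lim_proj 2 X (\<lambda>i. {}) 0 \<tau> = homologous_rel_set 2 X {} c"
    and "singular_relcycle 2 X {} c"
  shows "homologous_rel_set 2 X {} c \<in> hurewicz_image X {}"
proof -
  have "admissible_set X {} (topspace X)"
    by (simp add: admissible_set_def)
  then have "restricted_class X K {} (topspace X) \<tau> \<in> hurewicz_image X {}"
    using assms unfolding spherical_def by fastforce
  \<comment> \<open>Every index satisfies the inclusion when \<open>V\<close> is empty, so the least
    one is 0.\<close>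
  moreover have "restricted_class X K {} (topspace X) \<tau> = homologous_rel_set 2 X {} c"
    using assms hom_induced_id_class [of 2 X "{}" c "{}"]
    by (simp add: restricted_class_def end_nbhds_empty)
  ultimately show ?thesis
    by simp
qed

theorem proposition4p3:
  fixes M :: "'a topology" and n :: nat
  assumes "closed_SYS n M"
  shows "open_SYS (n + 1) (prod_topology M euclideanreal)"
proof -
  let ?X = "prod_topology M euclideanreal"
  let ?K = "slab M"
  let ?W = "end_nbhds ?K (topspace ?X)"
  obtain \<omega> \<mu> \<beta>s where "2 \<le> n" and M: "manifold n M" "compact_space M"
    and \<omega>: "orientation n M \<omega>" and \<mu>: "closed_fundamental_class n M \<omega> \<mu>"
    and \<beta>s: "length \<beta>s = n - 2" "set \<beta>s \<subseteq> cohomology 1 M {}"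
    and asph: "cap (n - 2) 2 M \<mu> (cup_list M \<beta>s) \<notin> hurewicz_image M {}"
    using assms unfolding closed_SYS_def closed_manifold_def by blast
  \<comment> \<open>Here m is the number of classes pulled back from \<open>M\<close>, and 1 + m is
    the degree of their product with \<open>?\<theta>\<close>. For m = 0 the product
    \<open>\<psi>\<close> is the unit cochain.\<close>
  obtain m where n: "n = m + 2"
    using \<open>2 \<le> n\<close> by (metis add.commute le_Suc_ex)
  obtain c where c: "singular_relcycle n M {} c" "\<mu> = homologous_rel_set n M {} c"
    using \<mu> unfolding closed_fundamental_class_def carrier_relative_homology_group by blast
  have cch: "singular_chain n M c"
    using c by (simp add: singular_cycle)
  obtain \<phi>s where \<phi>s: "\<beta>s = map (cohomology_class 1 M {}) \<phi>s"
    "\<And>\<phi>. \<phi> \<in> set \<phi>s \<Longrightarrow> singular_cocycle 1 M {} \<phi>"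
    using cohomology_list_reps [OF \<beta>s(2)] by blast
  have len: "length \<phi>s = m"
    using \<beta>s \<phi>s n by simp
  define \<psi> where "\<psi> = cochain_cup_list M \<phi>s"
  have \<psi>: "singular_cocycle m M {} \<psi>" "cup_list M \<beta>s = cohomology_class m M {} \<psi>"
    using singular_cocycle_cup_list [of \<phi>s M] cup_list_class [of \<phi>s M] \<phi>s len by (auto simp: \<psi>_def)
  have capM: "cap (n - 2) 2 M \<mu> (cup_list M \<beta>s) = homologous_rel_set 2 M {} (chain_cap m 2 c \<psi>)"
    using cap_class [of m 2 M c \<psi>] c \<psi> n by simp
  have fst: "continuous_map ?X M fst"
    by (rule continuous_map_fst)
  define \<phi>s' where "\<phi>s' = map (cochain_pullback 1 ?X fst) \<phi>s"
  define \<psi>' where "\<psi>' = cochain_pullback m ?X fst \<psi>"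
  have \<phi>s': "singular_cocycle 1 ?X {} \<phi>" if "\<phi> \<in> set \<phi>s'" for \<phi>
    using that \<phi>s(2) singular_cocycle_pullback [OF fst] by (auto simp: \<phi>s'_def)
  have \<psi>': "singular_cocycle m ?X {} \<psi>'"
    using singular_cocycle_pullback [OF fst \<psi>(1)] by (simp add: \<psi>'_def)
  have "cochain_cup_list ?X \<phi>s' = \<psi>'"
    using cochain_cup_list_pullback [OF fst, of \<phi>s] len by (simp add: \<phi>s'_def \<psi>'_def \<psi>_def)
  then have cupX: "cup_list ?X (map (cohomology_class 1 ?X {}) \<phi>s') = cohomology_class m ?X {} \<psi>'"
    using cup_list_class [of \<phi>s' ?X] \<phi>s' len by (simp add: \<phi>s'_def)
  define C where "C = (\<lambda>j. tower n c (j + 2))"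
  have exh: "exhaustion ?X ?K"
    using M by (simp add: exhaustion_slab)
  have C: "lim_cycle (Suc n) ?X ?W C"
    unfolding C_def using c(1) n by (intro lim_cycle_tower) auto
  have gen: "generates_group (relative_homology_group (int (Suc n)) ?X (topspace ?X - {z}))
      (homologous_rel_set (Suc n) ?X (topspace ?X - {z}) (C i))" if "z \<in> ?K i" for z i
  proof -
    obtain x t where z: "z = (x, t)"
      by (cases z)
    \<comment> \<open>Points of slab i have height at most i + 1 in absolute value, while the
      boundary of \<open>C i\<close> sits at heights i + 2 and -(i + 2).\<close>
    have x: "x \<in> topspace M" and t: "- real (i + 2) < t" "t < real (i + 2)"
      using that by (auto simp: z slab_def)
    have "generates_group (relative_homology_group (int n) M (topspace M - {x})) (\<omega> x)"
      using \<omega> x by (simp add: orientation_def)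
    moreover have "\<omega> x = homologous_rel_set n M (topspace M - {x}) c"
      using \<mu> x c hom_induced_id_class [of n M "{}" c "topspace M - {x}"]
      by (simp add: closed_fundamental_class_def)
    ultimately have gx: "generates_group (relative_homology_group (int n) M (topspace M - {x}))
        (homologous_rel_set n M (topspace M - {x}) c)"
      by simp
    have "closedin M {x}"
      using M x Hausdorff_imp_t1_space by (auto simp: manifold_def t1_space_closedin_singleton)
    then show ?thesis
      unfolding z
      by (rule generates_local_homology [OF _ t c(1) gx])
         (use cch c n in \<open>auto simp: C_def singular_chain_tower chain_boundary_tower\<close>)
  qed
  obtain \<omega>' where \<omega>': "orientation (Suc n) ?X \<omega>'"
    "fundamental_class (Suc n) ?X ?K \<omega>' (lim_homologous (Suc n) ?X ?W `` {C})"
    using orientation_of_lim_cycle [OF exh C gen] by blast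
  let ?\<theta> = "step_cocycle M"
  \<comment> \<open>Off slab 0 no point has height 0, so stage 0 of the colimit already carries the
    class of the step cocycle.\<close>
  have \<theta>: "singular_cocycle 1 ?X (?W 0) ?\<theta>"
    by (rule singular_cocycle_step) (auto simp: end_nbhds_def slab_def)
  define \<xi> where "\<xi> = cochain_cup 1 m ?X ?\<theta> \<psi>'"
  have \<xi>: "singular_cocycle (1 + m) ?X (?W 0) \<xi>"
    unfolding \<xi>_def using \<theta> \<psi>' by (rule singular_cocycle_cup)
  define \<beta>1 where "\<beta>1 = colim_rel 1 ?X ?W `` {(0, cohomology_class 1 ?X (?W 0) ?\<theta>)}"
  define D where "D = chain_cap (1 + m) 2 (C 0) \<xi>"
  \<comment> \<open>Capping with the step cocycle comes first and turns the tower into the copy of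
    \<open>c\<close> at height 0.\<close>
  have D: "D = chain_cap m 2 (chain_map n (\<lambda>x. (x, 0)) c) \<psi>'"
  proof -
    have "singular_chain (1 + m + 2) ?X (C 0)"
      using singular_chain_tower [OF cch, of "0 + 2"] n by (simp add: C_def)
    then have "D = chain_cap m 2 (chain_cap 1 (m + 2) (C 0) ?\<theta>) \<psi>'"
      unfolding D_def \<xi>_def by (rule chain_cap_cup)
    then show ?thesis
      using tower_cap_step [OF cch, of "0 + 2"] n by (simp add: C_def)
  qed
  have Dcyc: "singular_relcycle 2 ?X {} D"
    unfolding D_def using C \<xi> n
    by (intro singular_cycle_cap [where A = "?W 0"]) (auto simp: lim_cycle_def)
  \<comment> \<open>Since \<open>V\<close> is empty, the result is a constant sequence, given by the
    chain-level cap product at stage 0.\<close>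
  have "end_cap (1 + m) 2 ?X ?K {} (lim_homologous (Suc n) ?X ?W `` {C})
      (colim_cup 1 m ?X ?W \<beta>1 (cohomology_class m ?X {} \<psi>')) =
      lim_homologous 2 ?X (\<lambda>i. {}) `` {\<lambda>j. D}" (is "?\<tau> = _")
  proof -
    have deg: "1 + m + 2 = Suc n"
      using n by simp
    have "colim_cup 1 m ?X ?W \<beta>1 (cohomology_class m ?X {} \<psi>') =
        colim_rel (1 + m) ?X ?W `` {(0, cohomology_class (1 + m) ?X (?W 0) \<xi>)}"
      unfolding \<beta>1_def \<xi>_def using \<theta> \<psi>' antimono_end_nbhds [OF exh] by (rule colim_cup_class)
    then show ?thesis
      using end_cap_class [OF exh refl, of "1 + m" 2 C 0 \<xi>] C \<xi> unfolding deg D_def by simp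
  qed
  then have proj: "lim_proj 2 ?X (\<lambda>i. {}) 0 ?\<tau> = homologous_rel_set 2 ?X {} D"
    using lim_proj_class [OF lim_cycle_const [OF Dcyc]] by simp
  \<comment> \<open>Level 0 followed by the projection is the identity, so the projection formula
    recovers the cap product in \<open>M\<close> as an equality of chains.\<close>
  have push: "chain_map 2 fst D = chain_cap m 2 c \<psi>"
  proof -
    have c0: "singular_chain (m + 2) ?X (chain_map n (\<lambda>x. (x, 0)) c)"
      using singular_chain_chain_map [OF cch continuous_map_level] n by simp
    have "chain_map n fst (chain_map n (\<lambda>x. (x, 0::real)) c) = chain_map n (fst \<circ> (\<lambda>x. (x, 0::real))) c"
      by (simp only: chain_map_compose o_apply)
    also have "\<dots> = c"
      using cch by (intro chain_map_id_gen) auto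
    finally show ?thesis
      unfolding D \<psi>'_def chain_map_cap_pullback [OF c0] using n by simp
  qed
  have "aspherical ?X ?K {} ?\<tau>"
  proof
    assume "spherical ?X ?K {} ?\<tau>"
    then have "homologous_rel_set 2 ?X {} D \<in> hurewicz_image ?X {}"
      using proj Dcyc by (rule spherical_empty_imp_hurewicz)
    then have "hom_induced 2 ?X {} M {} fst (homologous_rel_set 2 ?X {} D) \<in> hurewicz_image M {}"
      by (intro hurewicz_image_naturality fst) auto
    moreover have "hom_induced 2 ?X {} M {} fst (homologous_rel_set 2 ?X {} D) =
        homologous_rel_set 2 M {} (chain_map 2 fst D)"
      using hom_induced_chain_map [OF fst _ Dcyc, of "{}"] by simp
    ultimately show False
      using asph capM push by simp
  qed
  moreover have "\<beta>1 \<in> colim_cohomology 1 ?X ?W"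
    unfolding \<beta>1_def using \<theta> by (rule colim_class_in)
  moreover have "set (map (cohomology_class 1 ?X {}) \<phi>s') \<subseteq> cohomology 1 ?X {}"
    by (auto intro!: cohomology_class_in \<phi>s' simp del: One_nat_def)
  moreover have "length (map (cohomology_class 1 ?X {}) \<phi>s') = n + 1 - 3"
    using len n by (simp add: \<phi>s'_def)
  moreover have "compact_frontier ?X {}"
    by (simp add: compact_frontier_def)
  moreover have "n + 1 - 2 = 1 + m" "n + 1 - 3 = m"
    using n by auto
  moreover have "manifold (n + 1) ?X" "3 \<le> n + 1"
    using manifold_prod_line [OF M(1)] n by simp_all
  ultimately show ?thesis
    unfolding open_SYS_def using exh \<omega>' cupX
    by (intro conjI exI [of _ ?K] exI [of _ \<omega>'] exI [of _ "lim_homologous (Suc n) ?X ?W `` {C}"]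
        exI [of _ "{}"] exI [of _ \<beta>1] exI [of _ "map (cohomology_class 1 ?X {}) \<phi>s'"]) simp_all
qed

end
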